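(* Let $f:\mathbb{N}\to\mathbb{N}\setminus\{0\}$ be strictly increasing. Let $\lambda$ be any infinite cardinal, let $\mu\le\lambda$ be an infinite cardinal, and let $\kappa$ be a cardinal with $\mu<\kappa$. Then no ultrafilter $\mathcal{D}$ on $\mathfrak{B}=\mathfrak{B}^1_{2^\lambda,\mu,\aleph_0}$ is $(\kappa^+,T_f)$-moral.
   Context: Definition of $T_f$. For $k<\omega$ let $\mathcal{T}_k=\{\eta\in{}^k\omega:\eta(\ell)\le f(\ell)\text{ for all }\ell<k\}$, $\mathcal{T}_{[k]}=\bigcup_{j\le k}\mathcal{T}_j$, $\mathcal{T}=\bigcup_k\mathcal{T}_k$; $\trianglelefteq$ between sequences is initial segment. Let $\mathcal{S}_0=\{\{\langle\rangle\}\}$, and for $k>0$ let $\mathcal{S}_k$ be the set of $s\subseteq\mathcal{T}_{[k]}$ such that $s$ is nonempty and closed under initial segments, every maximal node of $s$ is in $\mathcal{T}_k$, for no $\rho\in\mathcal{T}_{[k]}$ is $\{\rho^{\frown}\langle\ell\rangle:\ell\le f(\mathrm{lg}(\rho))\}\subseteq s$ (where $^{\frown}$ denotes concatenation of sequences), and $s$ is maximal subject to these conditions. $\mathcal{S}=\bigcup_k\mathcal{S}_k$. $T_{0,f}$ is the universal theory in the vocabulary $\{P,Q,R\}\cup\{P_\eta:\eta\in\mathcal{T}\}\cup\{Q_s:s\in\mathcal{S}\}$ ($R$ binary, the rest unary) whose models $M$ satisfy: (a) $P^M,Q^M$ partition $M$; (b) for each $k$, $\langle P_\eta^M:\eta\in\mathcal{T}_k\rangle$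 partitions $P^M$; (c) for each $k$, $\langle Q_s^M:s\in\mathcal{S}_k\rangle$ partitions $Q^M$ (empty pieces allowed); (d) $\eta\trianglelefteq\eta'\in\mathcal{T}$ implies $P^M_{\eta'}\subseteq P^M_\eta$, and $s\subseteq s'$ in $\mathcal{S}$ implies $Q^M_{s'}\subseteq Q^M_s$; (e) $R^M\subseteq Q^M\times P^M$; if $\eta\in\mathcal{T}_k$ and $b_\ell\in P^M_{\eta^{\frown}\langle\ell\rangle}$ for $\ell\le f(k)$ then no $x\in Q^M$ has $R(x,b_\ell)$ for all $\ell\le f(k)$; and if $(b,a)\in R^M$, $b\in Q_s^M$, $s\in\mathcal{S}_k$, $a\in P_\eta^M$, $\eta\in\mathcal{T}_k$ then $\eta\in s$. $T_f$ is the model completion of $T_{0,f}$ (which exists). Boolean algebra. $\mathrm{FI}_{\mu,\aleph_0}(2^\lambda)$ is the set of functions $h$ with finite $\mathrm{dom}(h)\subseteq 2^\lambda$ and $\mathrm{range}(h)\subseteq\mu$. $\mathfrak{B}^1_{2^\lambda,\mu,\aleph_0}$ is the completion of the free Boolean algebra generated by $2^\lambda$ independent partitions each of size $\mu$: the complete Boolean algebra with a dense set of nonzero elements $\{\mathbf{x}_h:h\in\mathrm{FI}_{\mu,\aleph_0}(2^\lambda)\}$ such that $\mathbf{x}_h\ge\mathbf{x}_{h'}$ iff $h\subseteq h'$, $\mathbf{x}_h\cap\mathbf{x}_{h'}=\mathbf{x}_{h\cup h'}$ if $h\cup h'$ is a function, and $=0$ otherwise. $\mathfrak{B}^+$ is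 the set of nonzero elements. Morality. Let $T$ be a complete countable theory, $\mathfrak{B}$ a complete Boolean algebra, $\kappa$ an infinite cardinal. Given formulas $\bar\varphi=\langle\varphi_\alpha(x,\bar y_\alpha):\alpha<\kappa\rangle$ of the language of $T$, a possibility pattern for $\bar\varphi$ is a sequence $\langle\mathbf{b}_u:u\in[\kappa]^{<\aleph_0}\rangle$ of elements of $\mathfrak{B}^+$ such that: $v\subseteq u$ implies $\mathbf{b}_u\le\mathbf{b}_v$; and whenever $u_*\in[\kappa]^{<\aleph_0}$ and $\mathbf{c}\in\mathfrak{B}^+$ are such that for every $u\subseteq u_*$ either $\mathbf{c}\le\mathbf{b}_u$ or $\mathbf{c}\cap\mathbf{b}_u=0$, there are $M\models T$ and tuples $\bar a_\alpha$ from $M$ ($\alpha\in u_*$) such that for every $u\subseteq u_*$, $M\models\exists x\bigwedge_{\alpha\in u}\varphi_\alpha(x,\bar a_\alpha)$ iff $\mathbf{c}\le\mathbf{b}_u$. An ultrafilter $\mathcal{D}$ on $\mathfrak{B}$ is $(\kappa^+,T)$-moral here if for every such $\bar\varphi$ of length $\kappa$, every possibility pattern for $\bar\varphi$ all of whose elements are in $\mathcal{D}$ has a multiplicative refinement in $\mathcal{D}$: a sequence $\langle\mathbf{b}'_u:u\in[\kappa]^{<\aleph_0}\rangle$ of elements of $\mathcal{D}$ with $\mathbf{b}'_u\le\mathbf{b}_u$ and $\mathbf{b}'_u\cap\mathbf{b}'_v=\mathbf{b}'_{u\cup v}$ for all $u,v$. *)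

theory Defs
  imports Main "HOL-Library.Sublist"
begin

unbundle cardinal_syntax

section \<open>First-order logic over a relational vocabulary\<close>

text \<open>A vocabulary assigns an arity to each of its symbols; \<open>None\<close> means that the symbol does not
  belong to it. Variables are named by natural numbers. The interpretation of a structure
  outside the vocabulary and outside the universe is irrelevant.\<close>

type_synonym 's vocabulary = "'s \<Rightarrow> nat option"

datatype 's fm =
    Fls
  | Rel 's "nat list"
  | Eq nat nat
  | Neg "'s fm"
  | Con "'s fm" "'s fm"
  | Ex nat "'s fm"

definition Dis :: "'s fm \<Rightarrow> 's fm \<Rightarrow> 's fm" where
  "Dis p q = Neg (Con (Neg p) (Neg q))"

definition Imp :: "'s fm \<Rightarrow> 's fm \<Rightarrow> 's fm" where
  "Imp p q = Neg (Con p (Neg q))"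

definition Iff :: "'s fm \<Rightarrow> 's fm \<Rightarrow> 's fm" where
  "Iff p q = Con (Imp p q) (Imp q p)"

definition All :: "nat \<Rightarrow> 's fm \<Rightarrow> 's fm" where
  "All n p = Neg (Ex n (Neg p))"

definition Dis_list :: "'s fm list \<Rightarrow> 's fm" where
  "Dis_list ps = foldr Dis ps Fls"

definition Con_list :: "'s fm list \<Rightarrow> 's fm" where
  "Con_list ps = foldr Con ps (Neg Fls)"

definition All_list :: "nat list \<Rightarrow> 's fm \<Rightarrow> 's fm" where
  "All_list ns p = foldr All ns p"

primrec fv :: "'s fm \<Rightarrow> nat set" where
  "fv Fls = {}"
| "fv (Rel r xs) = set xs"
| "fv (Eq x y) = {x, y}"
| "fv (Neg p) = fv p"
| "fv (Con p q) = fv p \<union> fv q"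
| "fv (Ex n p) = fv p - {n}"

primrec formula_of :: "'s vocabulary \<Rightarrow> 's fm \<Rightarrow> bool" where
  "formula_of V Fls \<longleftrightarrow> True"
| "formula_of V (Rel r xs) \<longleftrightarrow> V r = Some (length xs)"
| "formula_of V (Eq x y) \<longleftrightarrow> True"
| "formula_of V (Neg p) \<longleftrightarrow> formula_of V p"
| "formula_of V (Con p q) \<longleftrightarrow> formula_of V p \<and> formula_of V q"
| "formula_of V (Ex n p) \<longleftrightarrow> formula_of V p"

definition sentence_of :: "'s vocabulary \<Rightarrow> 's fm \<Rightarrow> bool" where
  "sentence_of V p \<longleftrightarrow> formula_of V p \<and> fv p = {}"

record ('s, 'm) struct =
  univ :: "'m set"
  interp :: "'s \<Rightarrow> 'm list \<Rightarrow> bool"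

primrec sat :: "('s, 'm) struct \<Rightarrow> (nat \<Rightarrow> 'm) \<Rightarrow> 's fm \<Rightarrow> bool" where
  "sat M v Fls \<longleftrightarrow> False"
| "sat M v (Rel r xs) \<longleftrightarrow> interp M r (map v xs)"
| "sat M v (Eq x y) \<longleftrightarrow> v x = v y"
| "sat M v (Neg p) \<longleftrightarrow> \<not> sat M v p"
| "sat M v (Con p q) \<longleftrightarrow> sat M v p \<and> sat M v q"
| "sat M v (Ex n p) \<longleftrightarrow> (\<exists>a\<in>univ M. sat M (v(n := a)) p)"

definition models :: "('s, 'm) struct \<Rightarrow> 's fm set \<Rightarrow> bool" where
  "models M T \<longleftrightarrow>
     univ M \<noteq> {} \<and> (\<forall>p\<in>T. \<forall>v. (\<forall>i. v i \<in> univ M) \<longrightarrow> sat M v p)"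

definition embedding ::
  "'s vocabulary \<Rightarrow> ('m \<Rightarrow> 'n) \<Rightarrow> ('s, 'm) struct \<Rightarrow> ('s, 'n) struct \<Rightarrow> bool" where
  "embedding V e M N \<longleftrightarrow>
     e ` univ M \<subseteq> univ N \<and> inj_on e (univ M) \<and>
     (\<forall>r as. V r = Some (length as) \<and> set as \<subseteq> univ M
        \<longrightarrow> (interp N r (map e as) \<longleftrightarrow> interp M r as))"

text \<open>\<open>T\<close> is the model completion of \<open>T0\<close>: it extends \<open>T0\<close>, every model of \<open>T0\<close> embeds in a
  model of \<open>T\<close>, and \<open>T\<close> together with the diagram of any model \<open>M\<close> of \<open>T0\<close> is complete (taking
  for \<open>M\<close> a model of \<open>T\<close> gives model completeness). Such a \<open>T\<close> is unique up to logical
  equivalence. HOL cannot quantify over the types of the universes, so structures live on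
  subsets of \<open>'m\<close>; for a countable vocabulary and an infinite type \<open>'m\<close> this is no restriction, by
  the Loewenheim-Skolem theorem. Embeddings are used instead of inclusions because the
  universe of \<open>M\<close> may be all of \<open>'m\<close>.\<close>

definition model_completion ::
  "'m itself \<Rightarrow> 's vocabulary \<Rightarrow> 's fm set \<Rightarrow> 's fm set \<Rightarrow> bool" where
  "model_completion (_ :: 'm itself) V T0 T \<longleftrightarrow>
     (\<forall>p\<in>T. sentence_of V p) \<and>
     (\<forall>M :: ('s, 'm) struct. models M T \<longrightarrow> models M T0) \<and>
     (\<forall>M :: ('s, 'm) struct. models M T0 \<longrightarrow>
        (\<exists>(N :: ('s, 'm) struct) e. models N T \<and> embedding V e M N)) \<and>
     (\<forall>(M :: ('s, 'm) struct) (N1 :: ('s, 'm) struct) (N2 :: ('s, 'm) struct) e1 e2 p v.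
        models M T0 \<and> models N1 T \<and> models N2 T \<and>
        embedding V e1 M N1 \<and> embedding V e2 M N2 \<and>
        formula_of V p \<and> (\<forall>i. v i \<in> univ M)
        \<longrightarrow> (sat N1 (e1 \<circ> v) p \<longleftrightarrow> sat N2 (e2 \<circ> v) p))"


section \<open>The theory \<open>T\<^sub>0\<^sub>,\<^sub>f\<close>\<close>

text \<open>Finite sequences of natural numbers are lists, and the initial segment relation is
  \<^const>\<open>prefix\<close>.\<close>

definition level :: "(nat \<Rightarrow> nat) \<Rightarrow> nat \<Rightarrow> nat list set" where
  "level f k = {\<eta>. length \<eta> = k \<and> (\<forall>l<k. \<eta> ! l \<le> f l)}"

definition levels_upto :: "(nat \<Rightarrow> nat) \<Rightarrow> nat \<Rightarrow> nat list set" where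
  "levels_upto f k = (\<Union>j\<le>k. level f j)"

definition nodes :: "(nat \<Rightarrow> nat) \<Rightarrow> nat list set" where
  "nodes f = (\<Union>k. level f k)"

definition thin_subtree :: "(nat \<Rightarrow> nat) \<Rightarrow> nat \<Rightarrow> nat list set \<Rightarrow> bool" where
  "thin_subtree f k s \<longleftrightarrow>
     s \<subseteq> levels_upto f k \<and> s \<noteq> {} \<and>
     (\<forall>\<eta>\<in>s. \<forall>\<rho>. prefix \<rho> \<eta> \<longrightarrow> \<rho> \<in> s) \<and>
     (\<forall>\<eta>\<in>s. (\<forall>\<rho>\<in>s. prefix \<eta> \<rho> \<longrightarrow> \<rho> = \<eta>) \<longrightarrow> \<eta> \<in> level f k) \<and>
     (\<forall>\<rho>\<in>levels_upto f k. \<not> {\<rho> @ [l] |l. l \<le> f (length \<rho>)} \<subseteq> s)"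

definition subtrees :: "(nat \<Rightarrow> nat) \<Rightarrow> nat \<Rightarrow> nat list set set" where
  "subtrees f k =
     (if k = 0 then {{[]}}
      else {s. thin_subtree f k s \<and> (\<forall>s'. thin_subtree f k s' \<and> s \<subseteq> s' \<longrightarrow> s' = s)})"

definition all_subtrees :: "(nat \<Rightarrow> nat) \<Rightarrow> nat list set set" where
  "all_subtrees f = (\<Union>k. subtrees f k)"

datatype sym = P | Q | R | Pn "nat list" | Qs "nat list set"

fun vocab :: "(nat \<Rightarrow> nat) \<Rightarrow> sym vocabulary" where
  "vocab f P = Some 1"
| "vocab f Q = Some 1"
| "vocab f R = Some 2"
| "vocab f (Pn \<eta>) = (if \<eta> \<in> nodes f then Some 1 else None)"
| "vocab f (Qs s) = (if s \<in> all_subtrees f then Some 1 else None)"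

text \<open>A disjunction over the finite set \<open>level f k\<close> (or \<open>subtrees f k\<close>) is written once for every
  enumeration of that set. In the second set of axioms in \<open>T0_e\<close>, variable \<open>0\<close> is \<open>x\<close> and
  variable \<open>Suc l\<close> is \<open>b\<^sub>l\<close>. The lemma \<open>models_T0_iff\<close> below gives the semantic form of all
  axioms.\<close>

definition T0_a :: "sym fm set" where
  "T0_a = {All 0 (Iff (Rel P [0]) (Neg (Rel Q [0])))}"

definition T0_b :: "(nat \<Rightarrow> nat) \<Rightarrow> sym fm set" where
  "T0_b f =
     {All 0 (Iff (Rel P [0]) (Dis_list (map (\<lambda>\<eta>. Rel (Pn \<eta>) [0]) \<eta>s))) |\<eta>s k.
        set \<eta>s = level f k} \<union>
     {All 0 (Neg (Con (Rel (Pn \<eta>) [0]) (Rel (Pn \<eta>') [0]))) |\<eta> \<eta>' k.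
        \<eta> \<in> level f k \<and> \<eta>' \<in> level f k \<and> \<eta> \<noteq> \<eta>'}"

definition T0_c :: "(nat \<Rightarrow> nat) \<Rightarrow> sym fm set" where
  "T0_c f =
     {All 0 (Iff (Rel Q [0]) (Dis_list (map (\<lambda>s. Rel (Qs s) [0]) ss))) |ss k.
        set ss = subtrees f k} \<union>
     {All 0 (Neg (Con (Rel (Qs s) [0]) (Rel (Qs s') [0]))) |s s' k.
        s \<in> subtrees f k \<and> s' \<in> subtrees f k \<and> s \<noteq> s'}"

definition T0_d :: "(nat \<Rightarrow> nat) \<Rightarrow> sym fm set" where
  "T0_d f =
     {All 0 (Imp (Rel (Pn \<eta>') [0]) (Rel (Pn \<eta>) [0])) |\<eta> \<eta>'.
        \<eta> \<in> nodes f \<and> \<eta>' \<in> nodes f \<and> prefix \<eta> \<eta>'} \<union>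
     {All 0 (Imp (Rel (Qs s') [0]) (Rel (Qs s) [0])) |s s'.
        s \<in> all_subtrees f \<and> s' \<in> all_subtrees f \<and> s \<subseteq> s'}"

definition T0_e :: "(nat \<Rightarrow> nat) \<Rightarrow> sym fm set" where
  "T0_e f =
     {All 0 (All 1 (Imp (Rel R [0, 1]) (Con (Rel Q [0]) (Rel P [1]))))} \<union>
     {All_list [0..<f k + 2]
        (Neg (Con (Rel Q [0])
          (Con_list (map (\<lambda>l. Con (Rel (Pn (\<eta> @ [l])) [Suc l]) (Rel R [0, Suc l]))
             [0..<f k + 1])))) |\<eta> k. \<eta> \<in> level f k} \<union>
     {All 0 (All 1 (Neg (Con (Rel R [0, 1]) (Con (Rel (Qs s) [0]) (Rel (Pn \<eta>) [1]))))) |s \<eta> k.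
        s \<in> subtrees f k \<and> \<eta> \<in> level f k \<and> \<eta> \<notin> s}"

definition T0 :: "(nat \<Rightarrow> nat) \<Rightarrow> sym fm set" where
  "T0 f = T0_a \<union> T0_b f \<union> T0_c f \<union> T0_d f \<union> T0_e f"


subsection \<open>The models of \<open>T\<^sub>0\<^sub>,\<^sub>f\<close>\<close>

definition ext :: "(sym, 'm) struct \<Rightarrow> sym \<Rightarrow> 'm set" where
  "ext M r = {a \<in> univ M. interp M r [a]}"

definition partitions :: "'i set \<Rightarrow> ('i \<Rightarrow> 'm set) \<Rightarrow> 'm set \<Rightarrow> bool" where
  "partitions I A X \<longleftrightarrow>
     (\<Union>i\<in>I. A i) = X \<and> (\<forall>i\<in>I. \<forall>j\<in>I. i \<noteq> j \<longrightarrow> A i \<inter> A j = {})"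

lemma sat_derived [simp]:
  "sat M v (Dis p q) \<longleftrightarrow> sat M v p \<or> sat M v q"
  "sat M v (Imp p q) \<longleftrightarrow> (sat M v p \<longrightarrow> sat M v q)"
  "sat M v (Iff p q) \<longleftrightarrow> (sat M v p \<longleftrightarrow> sat M v q)"
  "sat M v (All n p) \<longleftrightarrow> (\<forall>a\<in>univ M. sat M (v(n := a)) p)"
  by (auto simp: Dis_def Imp_def Iff_def All_def)

lemma sat_Dis_list [simp]: "sat M v (Dis_list ps) \<longleftrightarrow> (\<exists>p\<in>set ps. sat M v p)"
  by (induction ps) (auto simp: Dis_list_def)

lemma sat_Con_list [simp]: "sat M v (Con_list ps) \<longleftrightarrow> (\<forall>p\<in>set ps. sat M v p)"
  by (induction ps) (auto simp: Con_list_def)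

lemma sat_All_list:
  "sat M v (All_list ns p) \<longleftrightarrow>
     (\<forall>w. (\<forall>n\<in>set ns. w n \<in> univ M) \<and> (\<forall>n. n \<notin> set ns \<longrightarrow> w n = v n) \<longrightarrow> sat M w p)"
proof (induction ns arbitrary: v)
  case Nil
  have "w = v" if "\<forall>n. w n = v n" for w
    using that by auto
  then show ?case
    by (auto simp: All_list_def)
next
  case (Cons m ns)
  have "sat M v (All_list (m # ns) p) \<longleftrightarrow> (\<forall>a\<in>univ M. sat M (v(m := a)) (All_list ns p))"
    by (simp add: All_list_def)
  also have "\<dots> \<longleftrightarrow> (\<forall>a\<in>univ M. \<forall>w. (\<forall>n\<in>set ns. w n \<in> univ M) \<and>
      (\<forall>n. n \<notin> set ns \<longrightarrow> w n = (v(m := a)) n) \<longrightarrow> sat M w p)"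
    by (simp only: Cons.IH)
  also have "\<dots> \<longleftrightarrow> (\<forall>w. (\<forall>n\<in>set (m # ns). w n \<in> univ M) \<and>
      (\<forall>n. n \<notin> set (m # ns) \<longrightarrow> w n = v n) \<longrightarrow> sat M w p)" (is "?A \<longleftrightarrow> ?B")
  proof
    assume A: ?A
    show ?B
    proof (intro allI impI)
      fix w
      assume w: "(\<forall>n\<in>set (m # ns). w n \<in> univ M) \<and> (\<forall>n. n \<notin> set (m # ns) \<longrightarrow> w n = v n)"
      then have "\<forall>n. n \<notin> set ns \<longrightarrow> w n = (v(m := w m)) n" "w m \<in> univ M"
        by auto
      with A w show "sat M w p"
        by (metis list.set_intros(2))
    qed
  next
    assume B: ?B
    show ?A
    proof (intro ballI allI impI)
      fix a w
      assume "a \<in> univ M"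
        and "(\<forall>n\<in>set ns. w n \<in> univ M) \<and> (\<forall>n. n \<notin> set ns \<longrightarrow> w n = (v(m := a)) n)"
      then have "(\<forall>n\<in>set (m # ns). w n \<in> univ M) \<and> (\<forall>n. n \<notin> set (m # ns) \<longrightarrow> w n = v n)"
        by (auto split: if_splits)
      with B show "sat M w p"
        by blast
    qed
  qed
  finally show ?case .
qed

lemma finite_level: "finite (level f k)"
proof -
  have "level f k \<subseteq> {\<eta>. set \<eta> \<subseteq> {..Max (f ` {..k})} \<and> length \<eta> = k}"
    by (fastforce simp: level_def in_set_conv_nth intro: order_trans[OF _ Max_ge])
  then show ?thesis
    using finite_lists_length_eq[of "{..Max (f ` {..k})}" k] finite_subset by blast
qed

lemma finite_subtrees: "finite (subtrees f k)"
proof -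
  have "subtrees f k \<subseteq> insert {[]} (Pow (levels_upto f k))"
    by (auto simp: subtrees_def thin_subtree_def)
  moreover have "finite (levels_upto f k)"
    by (simp add: levels_upto_def finite_level)
  ultimately show ?thesis
    by (meson finite.insertI finite_Pow_iff finite_subset)
qed

lemma models_Un: "models M (A \<union> B) \<longleftrightarrow> models M A \<and> models M B"
  by (auto simp: models_def)

lemma models_T0_a:
  "models M T0_a \<longleftrightarrow>
     univ M \<noteq> {} \<and> ext M P \<union> ext M Q = univ M \<and> ext M P \<inter> ext M Q = {}"
proof (cases "univ M = {}")
  case False
  then obtain a where "a \<in> univ M" by auto
  then have "\<exists>v::nat \<Rightarrow> _. \<forall>i. v i \<in> univ M" by (intro exI[of _ "\<lambda>_. a"]) auto
  then show ?thesis
    using False by (auto simp: models_def T0_a_def ext_def)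
qed (auto simp: models_def)

lemma ex_assignment: "univ M \<noteq> {} \<Longrightarrow> \<exists>v::nat \<Rightarrow> _. \<forall>i. v i \<in> univ M"
  by (meson all_not_in_conv)

lemma ball_Collect2:
  "(\<forall>p\<in>{F x y |x y. C x y}. \<Phi> p) \<longleftrightarrow> (\<forall>x y. C x y \<longrightarrow> \<Phi> (F x y))"
  by blast

lemma ball_Collect3:
  "(\<forall>p\<in>{F x y |x y z. C x y z}. \<Phi> p) \<longleftrightarrow> (\<forall>x y z. C x y z \<longrightarrow> \<Phi> (F x y))"
  by blast

lemma ball_Collect2':
  "(\<forall>p\<in>{F x |x z. C x z}. \<Phi> p) \<longleftrightarrow> (\<forall>x z. C x z \<longrightarrow> \<Phi> (F x))"
  by blast

lemma all_enumerations:
  assumes "\<And>k. finite (A k)"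
  shows "(\<forall>xs k. set xs = A k \<longrightarrow> C k (set xs)) \<longleftrightarrow> (\<forall>k. C k (A k))"
proof
  assume C: "\<forall>xs k. set xs = A k \<longrightarrow> C k (set xs)"
  show "\<forall>k. C k (A k)"
  proof
    fix k
    obtain xs where "set xs = A k"
      using finite_list[OF assms] by blast
    with C show "C k (A k)"
      by metis
  qed
qed auto

lemma models_T0_b:
  "models M (T0_b f) \<longleftrightarrow>
     univ M \<noteq> {} \<and> (\<forall>k. partitions (level f k) (\<lambda>\<eta>. ext M (Pn \<eta>)) (ext M P))"
proof (cases "univ M = {}")
  case False
  note v = ex_assignment[OF False]
  have "models M (T0_b f) \<longleftrightarrow>
    (\<forall>\<eta>s k. set \<eta>s = level f k \<longrightarrow>
       (\<forall>a\<in>univ M. interp M P [a] \<longleftrightarrow> (\<exists>\<eta>\<in>set \<eta>s. interp M (Pn \<eta>) [a]))) \<and>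
    (\<forall>k \<eta> \<eta>'. \<eta> \<in> level f k \<and> \<eta>' \<in> level f k \<and> \<eta> \<noteq> \<eta>' \<longrightarrow>
       (\<forall>a\<in>univ M. \<not> (interp M (Pn \<eta>) [a] \<and> interp M (Pn \<eta>') [a])))"
    unfolding models_def T0_b_def ball_Un ball_Collect2 ball_Collect3 ball_Collect2'
    by (simp add: v False) blast
  also have "\<dots> \<longleftrightarrow>
    (\<forall>k. \<forall>a\<in>univ M. interp M P [a] \<longleftrightarrow> (\<exists>\<eta>\<in>level f k. interp M (Pn \<eta>) [a])) \<and>
    (\<forall>k \<eta> \<eta>'. \<eta> \<in> level f k \<and> \<eta>' \<in> level f k \<and> \<eta> \<noteq> \<eta>' \<longrightarrow>
       (\<forall>a\<in>univ M. \<not> (interp M (Pn \<eta>) [a] \<and> interp M (Pn \<eta>') [a])))"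
    by (subst all_enumerations[OF finite_level]) (rule refl)
  also have "\<dots> \<longleftrightarrow> (\<forall>k. partitions (level f k) (\<lambda>\<eta>. ext M (Pn \<eta>)) (ext M P))"
    unfolding partitions_def ext_def by blast
  finally show ?thesis using False by simp
qed (auto simp: models_def)

lemma models_T0_c:
  "models M (T0_c f) \<longleftrightarrow>
     univ M \<noteq> {} \<and> (\<forall>k. partitions (subtrees f k) (\<lambda>s. ext M (Qs s)) (ext M Q))"
proof (cases "univ M = {}")
  case False
  note v = ex_assignment[OF False]
  have "models M (T0_c f) \<longleftrightarrow>
    (\<forall>ss k. set ss = subtrees f k \<longrightarrow>
       (\<forall>a\<in>univ M. interp M Q [a] \<longleftrightarrow> (\<exists>s\<in>set ss. interp M (Qs s) [a]))) \<and>
    (\<forall>k s s'. s \<in> subtrees f k \<and> s' \<in> subtrees f k \<and> s \<noteq> s' \<longrightarrow>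
       (\<forall>a\<in>univ M. \<not> (interp M (Qs s) [a] \<and> interp M (Qs s') [a])))"
    unfolding models_def T0_c_def ball_Un ball_Collect2 ball_Collect3 ball_Collect2'
    by (simp add: v False) blast
  also have "\<dots> \<longleftrightarrow>
    (\<forall>k. \<forall>a\<in>univ M. interp M Q [a] \<longleftrightarrow> (\<exists>s\<in>subtrees f k. interp M (Qs s) [a])) \<and>
    (\<forall>k s s'. s \<in> subtrees f k \<and> s' \<in> subtrees f k \<and> s \<noteq> s' \<longrightarrow>
       (\<forall>a\<in>univ M. \<not> (interp M (Qs s) [a] \<and> interp M (Qs s') [a])))"
    by (subst all_enumerations[OF finite_subtrees]) (rule refl)
  also have "\<dots> \<longleftrightarrow> (\<forall>k. partitions (subtrees f k) (\<lambda>s. ext M (Qs s)) (ext M Q))"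
    unfolding partitions_def ext_def by blast
  finally show ?thesis using False by simp
qed (auto simp: models_def)

lemma models_T0_d:
  "models M (T0_d f) \<longleftrightarrow>
     univ M \<noteq> {} \<and>
     (\<forall>\<eta>\<in>nodes f. \<forall>\<eta>'\<in>nodes f. prefix \<eta> \<eta>' \<longrightarrow> ext M (Pn \<eta>') \<subseteq> ext M (Pn \<eta>)) \<and>
     (\<forall>s\<in>all_subtrees f. \<forall>s'\<in>all_subtrees f. s \<subseteq> s' \<longrightarrow> ext M (Qs s') \<subseteq> ext M (Qs s))"
proof (cases "univ M = {}")
  case False
  note v = ex_assignment[OF False]
  have "models M (T0_d f) \<longleftrightarrow>
    (\<forall>\<eta> \<eta>'. \<eta> \<in> nodes f \<and> \<eta>' \<in> nodes f \<and> prefix \<eta> \<eta>' \<longrightarrow>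
       (\<forall>a\<in>univ M. interp M (Pn \<eta>') [a] \<longrightarrow> interp M (Pn \<eta>) [a])) \<and>
    (\<forall>s s'. s \<in> all_subtrees f \<and> s' \<in> all_subtrees f \<and> s \<subseteq> s' \<longrightarrow>
       (\<forall>a\<in>univ M. interp M (Qs s') [a] \<longrightarrow> interp M (Qs s) [a]))"
    unfolding models_def T0_d_def ball_Un ball_Collect2 ball_Collect3 ball_Collect2'
    by (simp add: v False)
  then show ?thesis
    using False unfolding ext_def by blast
qed (auto simp: models_def)

lemma models_T0_e:
  "models M (T0_e f) \<longleftrightarrow>
     univ M \<noteq> {} \<and>
     (\<forall>b\<in>univ M. \<forall>a\<in>univ M. interp M R [b, a] \<longrightarrow> b \<in> ext M Q \<and> a \<in> ext M P) \<and>
     (\<forall>k. \<forall>\<eta>\<in>level f k. \<forall>b. (\<forall>l\<le>f k. b l \<in> ext M (Pn (\<eta> @ [l]))) \<longrightarrow>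
        \<not> (\<exists>x\<in>ext M Q. \<forall>l\<le>f k. interp M R [x, b l])) \<and>
     (\<forall>k. \<forall>s\<in>subtrees f k. \<forall>\<eta>\<in>level f k. \<forall>b\<in>ext M (Qs s). \<forall>a\<in>ext M (Pn \<eta>).
        interp M R [b, a] \<longrightarrow> \<eta> \<in> s)"
proof (cases "univ M = {}")
  case False
  note v = ex_assignment[OF False]
  have eq: "(\<forall>v::nat \<Rightarrow> _. (\<forall>i. v i \<in> univ M) \<longrightarrow> C) \<longleftrightarrow> C" for C
    using v by blast
  define A2 where "A2 = (\<lambda>\<eta> k. All_list [0..<f k + 2]
        (Neg (Con (Rel Q [0])
          (Con_list (map (\<lambda>l. Con (Rel (Pn (\<eta> @ [l])) [Suc l]) (Rel R [0, Suc l]))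
             [0..<f k + 1])))))"
  have sat_A2: "sat M v (A2 \<eta> k) \<longleftrightarrow> (\<forall>b. (\<forall>l\<le>f k. b l \<in> ext M (Pn (\<eta> @ [l]))) \<longrightarrow>
        \<not> (\<exists>x\<in>ext M Q. \<forall>l\<le>f k. interp M R [x, b l]))" (is "?L \<longleftrightarrow> ?R")
    for v \<eta> k
  proof
    assume L: ?L
    show ?R
    proof (intro allI impI notI)
      fix b
      assume b: "\<forall>l\<le>f k. b l \<in> ext M (Pn (\<eta> @ [l]))"
        and "\<exists>x\<in>ext M Q. \<forall>l\<le>f k. interp M R [x, b l]"
      then obtain x where x: "x \<in> ext M Q" "\<forall>l\<le>f k. interp M R [x, b l]"
        by auto
      let ?w = "\<lambda>n. if n < f k + 2 then (case n of 0 \<Rightarrow> x | Suc l \<Rightarrow> b l) else v n"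
      have "(\<forall>n\<in>set [0..<f k + 2]. ?w n \<in> univ M) \<and> (\<forall>n. n \<notin> set [0..<f k + 2] \<longrightarrow> ?w n = v n)"
        using b x by (auto simp: ext_def split: nat.splits)
      note L[unfolded A2_def sat_All_list, THEN spec, THEN mp, OF this]
      then have "sat M ?w (Neg (Con (Rel Q [0])
          (Con_list (map (\<lambda>l. Con (Rel (Pn (\<eta> @ [l])) [Suc l]) (Rel R [0, Suc l]))
             [0..<f k + 1]))))"
        .
      with b x show False
        by (fastforce simp: ext_def less_Suc_eq_le simp del: upt_Suc)
    qed
  next
    assume r: ?R
    show ?L
      unfolding A2_def sat_All_list
    proof (intro allI impI)
      fix w
      assume "(\<forall>n\<in>set [0..<f k + 2]. w n \<in> univ M) \<and> (\<forall>n. n \<notin> set [0..<f k + 2] \<longrightarrow> w n = v n)"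
      then have "\<forall>n<f k + 2. w n \<in> univ M"
        by (simp only: set_upt atLeastLessThan_iff) simp
      then have "w 0 \<in> univ M" "\<forall>l\<le>f k. w (Suc l) \<in> univ M" by auto
      with r[rule_format, of "\<lambda>l. w (Suc l)"] show "sat M w (Neg (Con (Rel Q [0])
          (Con_list (map (\<lambda>l. Con (Rel (Pn (\<eta> @ [l])) [Suc l]) (Rel R [0, Suc l]))
             [0..<f k + 1]))))"
        by (fastforce simp: ext_def less_Suc_eq_le simp del: upt_Suc)
    qed
  qed
  have T0_e: "T0_e f =
    {All 0 (All 1 (Imp (Rel R [0, 1]) (Con (Rel Q [0]) (Rel P [1]))))} \<union>
    {A2 \<eta> k |\<eta> k. \<eta> \<in> level f k} \<union>
    {All 0 (All 1 (Neg (Con (Rel R [0, 1]) (Con (Rel (Qs s) [0]) (Rel (Pn \<eta>) [1]))))) |s \<eta> k.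
       s \<in> subtrees f k \<and> \<eta> \<in> level f k \<and> \<eta> \<notin> s}"
    by (simp only: T0_e_def A2_def)
  have "models M (T0_e f) \<longleftrightarrow>
    (\<forall>b\<in>univ M. \<forall>a\<in>univ M. interp M R [b, a] \<longrightarrow> interp M Q [b] \<and> interp M P [a]) \<and>
    (\<forall>\<eta> k. \<eta> \<in> level f k \<longrightarrow> (\<forall>v. (\<forall>i. v i \<in> univ M) \<longrightarrow> sat M v (A2 \<eta> k))) \<and>
    (\<forall>s \<eta> k. s \<in> subtrees f k \<and> \<eta> \<in> level f k \<and> \<eta> \<notin> s \<longrightarrow>
       (\<forall>b\<in>univ M. \<forall>a\<in>univ M. \<not> (interp M R [b, a] \<and> interp M (Qs s) [b] \<and> interp M (Pn \<eta>) [a])))"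
    unfolding models_def T0_e ball_Un ball_Collect2 ball_Collect3 ball_Collect2'
    using False by (simp add: v)
  also have "\<dots> \<longleftrightarrow>
    (\<forall>b\<in>univ M. \<forall>a\<in>univ M. interp M R [b, a] \<longrightarrow> b \<in> ext M Q \<and> a \<in> ext M P) \<and>
     (\<forall>k. \<forall>\<eta>\<in>level f k. \<forall>b. (\<forall>l\<le>f k. b l \<in> ext M (Pn (\<eta> @ [l]))) \<longrightarrow>
        \<not> (\<exists>x\<in>ext M Q. \<forall>l\<le>f k. interp M R [x, b l])) \<and>
     (\<forall>k. \<forall>s\<in>subtrees f k. \<forall>\<eta>\<in>level f k. \<forall>b\<in>ext M (Qs s). \<forall>a\<in>ext M (Pn \<eta>).
        interp M R [b, a] \<longrightarrow> \<eta> \<in> s)"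
  proof (intro arg_cong2[where f = "(\<and>)"], goal_cases)
    case 1 show ?case by (auto simp: ext_def)
  next
    case 2 show ?case
      unfolding sat_A2 eq Ball_def by (rule all_comm)
  next
    case 3
    show ?case (is "?A \<longleftrightarrow> ?B")
    proof
      assume ?A then show ?B unfolding ext_def by blast
    next
      assume B: ?B
      show ?A
      proof (intro allI impI ballI notI, elim conjE)
        fix s \<eta> k b a
        assume "s \<in> subtrees f k" "\<eta> \<in> level f k" "\<eta> \<notin> s" "b \<in> univ M" "a \<in> univ M"
          "interp M R [b, a]" "interp M (Qs s) [b]" "interp M (Pn \<eta>) [a]"
        moreover from this have "b \<in> ext M (Qs s)" "a \<in> ext M (Pn \<eta>)"
          by (simp_all add: ext_def)
        ultimately show False using B by metis
      qed
    qed
  qed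
  finally show ?thesis using False by simp
qed (auto simp: models_def)

lemma models_T0_iff:
  "models M (T0 f) \<longleftrightarrow>
     univ M \<noteq> {} \<and>
     ext M P \<union> ext M Q = univ M \<and> ext M P \<inter> ext M Q = {} \<and>
     (\<forall>k. partitions (level f k) (\<lambda>\<eta>. ext M (Pn \<eta>)) (ext M P)) \<and>
     (\<forall>k. partitions (subtrees f k) (\<lambda>s. ext M (Qs s)) (ext M Q)) \<and>
     (\<forall>\<eta>\<in>nodes f. \<forall>\<eta>'\<in>nodes f. prefix \<eta> \<eta>' \<longrightarrow> ext M (Pn \<eta>') \<subseteq> ext M (Pn \<eta>)) \<and>
     (\<forall>s\<in>all_subtrees f. \<forall>s'\<in>all_subtrees f. s \<subseteq> s' \<longrightarrow> ext M (Qs s') \<subseteq> ext M (Qs s)) \<and>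
     (\<forall>b\<in>univ M. \<forall>a\<in>univ M. interp M R [b, a] \<longrightarrow> b \<in> ext M Q \<and> a \<in> ext M P) \<and>
     (\<forall>k. \<forall>\<eta>\<in>level f k. \<forall>b. (\<forall>l\<le>f k. b l \<in> ext M (Pn (\<eta> @ [l]))) \<longrightarrow>
        \<not> (\<exists>x\<in>ext M Q. \<forall>l\<le>f k. interp M R [x, b l])) \<and>
     (\<forall>k. \<forall>s\<in>subtrees f k. \<forall>\<eta>\<in>level f k. \<forall>b\<in>ext M (Qs s). \<forall>a\<in>ext M (Pn \<eta>).
        interp M R [b, a] \<longrightarrow> \<eta> \<in> s)"
  unfolding T0_def models_Un models_T0_a models_T0_b models_T0_c models_T0_d models_T0_e
  by (cases "univ M = {}") (simp_all only: simp_thms not_True_eq_False conj_assoc)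


section \<open>The Boolean algebra\<close>

text \<open>The class \<open>complete_boolean_algebra\<close> of the library demands complete distributivity, hence
  atomicity, and would be wrong here; a complete Boolean algebra is a type of sort
  \<open>{boolean_algebra, complete_lattice}\<close>.

  With \<open>'i\<close> the index type of the partitions and \<open>'u\<close> the index type of the pieces of each of
  them, the set of all \<open>h :: 'i \<rightharpoonup> 'u\<close> with \<open>finite (dom h)\<close> is FI. The predicate says that \<open>X\<close>
  presents the type \<open>'b\<close> as the completion of the free Boolean algebra generated by
  \<open>|'i|\<close> independent partitions of size \<open>|'u|\<close>; this determines \<open>'b\<close> up to isomorphism.
  If \<open>h\<close> and \<open>h'\<close> agree on their common domain, their union is \<open>h ++ h'\<close>.\<close>

definition free_completion ::
  "(('i \<rightharpoonup> 'u) \<Rightarrow> 'b::{boolean_algebra, complete_lattice}) \<Rightarrow> bool" where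
  "free_completion X \<longleftrightarrow>
     (\<forall>h. finite (dom h) \<longrightarrow> X h \<noteq> bot) \<and>
     (\<forall>b. b \<noteq> bot \<longrightarrow> (\<exists>h. finite (dom h) \<and> X h \<le> b)) \<and>
     (\<forall>h h'. finite (dom h) \<and> finite (dom h') \<longrightarrow>
        (X h' \<le> X h \<longleftrightarrow> h \<subseteq>\<^sub>m h') \<and>
        inf (X h) (X h') =
          (if \<forall>i \<in> dom h \<inter> dom h'. h i = h' i then X (h ++ h') else bot))"

definition ultrafilter :: "'b::boolean_algebra set \<Rightarrow> bool" where
  "ultrafilter D \<longleftrightarrow>
     top \<in> D \<and> bot \<notin> D \<and>
     (\<forall>a\<in>D. \<forall>b\<in>D. inf a b \<in> D) \<and>
     (\<forall>a\<in>D. \<forall>b. a \<le> b \<longrightarrow> b \<in> D) \<and>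
     (\<forall>a. a \<in> D \<or> - a \<in> D)"


section \<open>Morality\<close>

text \<open>The cardinal \<open>\<kappa>\<close> is represented by the index type \<open>'k\<close>, and only the values at finite sets of
  a function \<open>b :: 'k set \<Rightarrow> 'b\<close> matter. In a formula \<open>\<phi> \<alpha>\<close>, variable \<open>0\<close> is the variable \<open>x\<close>, and
  all other variables are parameter variables; a tuple of parameters is an
  assignment, of which only the values at the finitely many free variables of the formula
  matter.\<close>

definition possibility_pattern ::
  "'m itself \<Rightarrow> 's fm set \<Rightarrow> ('k \<Rightarrow> 's fm) \<Rightarrow> ('k set \<Rightarrow> 'b::boolean_algebra) \<Rightarrow> bool" where
  "possibility_pattern (_ :: 'm itself) T \<phi> b \<longleftrightarrow>
     (\<forall>u. finite u \<longrightarrow> b u \<noteq> bot) \<and>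
     (\<forall>u v. finite u \<and> v \<subseteq> u \<longrightarrow> b u \<le> b v) \<and>
     (\<forall>w c. finite w \<and> c \<noteq> bot \<and> (\<forall>u\<subseteq>w. c \<le> b u \<or> inf c (b u) = bot) \<longrightarrow>
        (\<exists>(M :: ('s, 'm) struct) a. models M T \<and> (\<forall>\<alpha>\<in>w. \<forall>i. a \<alpha> i \<in> univ M) \<and>
           (\<forall>u\<subseteq>w. (\<exists>x\<in>univ M. \<forall>\<alpha>\<in>u. sat M ((a \<alpha>)(0 := x)) (\<phi> \<alpha>)) \<longleftrightarrow> c \<le> b u)))"

definition multiplicative_refinement ::
  "('k set \<Rightarrow> 'b::boolean_algebra) \<Rightarrow> ('k set \<Rightarrow> 'b) \<Rightarrow> bool" where
  "multiplicative_refinement b b' \<longleftrightarrow>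
     (\<forall>u. finite u \<longrightarrow> b' u \<le> b u) \<and>
     (\<forall>u v. finite u \<and> finite v \<longrightarrow> inf (b' u) (b' v) = b' (u \<union> v))"

text \<open>\<open>moral TYPE('k) TYPE('m) V T D\<close> is \<open>(\<kappa>\<^sup>+, T)\<close>-morality for \<open>\<kappa> = |'k|\<close>, where \<open>V\<close> is the
  vocabulary of the theory \<open>T\<close>. As before, models of \<open>T\<close> live on subsets of the infinite
  type \<open>'m\<close>.\<close>

definition moral ::
  "'k itself \<Rightarrow> 'm itself \<Rightarrow> 's vocabulary \<Rightarrow> 's fm set \<Rightarrow>
     'b::{boolean_algebra, complete_lattice} set \<Rightarrow> bool" where
  "moral (_ :: 'k itself) (_ :: 'm itself) V T D \<longleftrightarrow>
     (\<forall>(\<phi> :: 'k \<Rightarrow> 's fm) (b :: 'k set \<Rightarrow> 'b).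
        (\<forall>\<alpha>. formula_of V (\<phi> \<alpha>)) \<and> possibility_pattern TYPE('m) T \<phi> b \<and>
        (\<forall>u. finite u \<longrightarrow> b u \<in> D) \<longrightarrow>
        (\<exists>b'. (\<forall>u. finite u \<longrightarrow> b' u \<in> D) \<and> multiplicative_refinement b b'))"

end

theory Submission
  imports Defs "HOL-Library.Countable"
begin

text \<open>Let \<open>\<mu> = |'u|\<close>. A generic point of the free completion assigns one of \<open>\<mu>\<close> values to each of
  its independent partitions. Reserve infinitely many partitions for each of more than \<open>\<mu>\<close> indices
  \<open>\<alpha>\<close>, and let the values of the partitions reserved for \<open>\<alpha>\<close> choose, level by level, a branch of the
  tree \<open>nodes f\<close> (all other indices get arbitrary branches). The branch of \<open>\<alpha>\<close> says in which of
  the predicates \<open>Pn \<eta>\<close> an imagined parameter \<open>a\<^sub>\<alpha>\<close> lies. Any finitely many such parameters can be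
  found in a model of \<open>T\<^sub>f\<close> in which the formulas \<open>R(x, a\<^sub>\<alpha>)\<close>, \<open>\<alpha> \<in> u\<close>, are consistent iff the branches
  in \<open>u\<close> are thin: no node has all its successors on them (\<open>model_completion_thin\<close>). So the
  Boolean values of thinness form a possibility pattern (\<open>thin_branches_possibility_pattern\<close>).

  The pattern lies in the ultrafilter \<open>D\<close> if the coding of labels by partition values is chosen
  with \<open>D\<close> in view: \<open>D\<close> shall believe that each branch takes the successor \<open>0\<close> at each level
  (\<open>generic_labels\<close>). As \<open>f\<close> is strictly increasing, \<open>n\<close> branches can violate thinness at
  levels below \<open>n\<close> only, so the thinness of a finite family follows from finitely many of these
  beliefs (\<open>thin_branches_in_ultrafilter\<close>).

  A multiplicative refinement \<open>b'\<close> would give for each \<open>\<alpha>\<close> a condition below \<open>b' {\<alpha>}\<close>. Such a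
  condition is finite and so leaves some first step of the branch of \<open>\<alpha>\<close> open. As there are more than \<open>\<mu>\<close>
  indices but only \<open>\<mu>\<close> values, a \<open>\<Delta>\<close>-system argument (\<open>delta_system\<close>) yields infinitely many \<open>\<alpha>\<close> with
  pairwise compatible conditions that decide the branches up to the same node \<open>\<rho>\<close> and leave the
  next step of all these branches open. The union of finitely many of these conditions lies below the value of thinness
  by multiplicativity, and yet has an extension in which these branches run through all
  successors of \<open>\<rho>\<close> (\<open>no_multiplicative_refinement\<close>).\<close>


section \<open>Finite models of the universal theory\<close>

lemma mem_nodes: "\<eta> \<in> nodes f \<longleftrightarrow> (\<forall>i<length \<eta>. \<eta> ! i \<le> f i)"
  by (auto simp: nodes_def level_def)

lemma mem_level: "\<eta> \<in> level f k \<longleftrightarrow> \<eta> \<in> nodes f \<and> length \<eta> = k"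
  by (auto simp: mem_nodes level_def)

lemma mem_levels_upto: "\<eta> \<in> levels_upto f k \<longleftrightarrow> \<eta> \<in> nodes f \<and> length \<eta> \<le> k"
  by (auto simp: mem_nodes levels_upto_def level_def)

lemma snoc_mem_nodes: "\<eta> @ [l] \<in> nodes f \<longleftrightarrow> \<eta> \<in> nodes f \<and> l \<le> f (length \<eta>)"
  by (auto simp: mem_nodes nth_append less_Suc_eq)

text \<open>No node has all its successors on the branches indexed by \<open>u\<close>. The list \<open>\<rho>\<close> ranges
  over all lists, since no branch of the tree passes through a list outside the tree.\<close>

definition thin_branches :: "(nat \<Rightarrow> nat) \<Rightarrow> ('a \<Rightarrow> nat \<Rightarrow> nat) \<Rightarrow> 'a set \<Rightarrow> bool" where
  "thin_branches f B u \<longleftrightarrow>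
     (\<forall>\<rho>. \<exists>l\<le>f (length \<rho>). \<forall>\<alpha>\<in>u. map (B \<alpha>) [0..<Suc (length \<rho>)] \<noteq> \<rho> @ [l])"

lemma thin_branches_mono: "thin_branches f B u \<Longrightarrow> v \<subseteq> u \<Longrightarrow> thin_branches f B v"
  unfolding thin_branches_def by blast

text \<open>The function \<open>g\<close> names for each node the successor that is left out.\<close>

definition avoiding :: "(nat \<Rightarrow> nat) \<Rightarrow> (nat list \<Rightarrow> nat) \<Rightarrow> nat list set" where
  "avoiding f g = {\<eta> \<in> nodes f. \<forall>i<length \<eta>. \<eta> ! i \<noteq> g (take i \<eta>)}"

lemma snoc_mem_avoiding:
  "\<eta> @ [l] \<in> avoiding f g \<longleftrightarrow> \<eta> \<in> avoiding f g \<and> l \<le> f (length \<eta>) \<and> l \<noteq> g \<eta>"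
  unfolding avoiding_def mem_Collect_eq snoc_mem_nodes
  by (auto simp: nth_append less_Suc_eq)

text \<open>Where every node of a tree lacks exactly one of its successors, adding any node completes
  the successors of some node; this is why such a tree is maximal.\<close>

lemma avoiding_mem_subtrees:
  assumes pos: "\<And>n. f n \<noteq> 0" and g: "\<And>\<rho>. g \<rho> \<le> f (length \<rho>)"
  shows "avoiding f g \<inter> levels_upto f k \<in> subtrees f k"
proof (cases "k = 0")
  case True
  have "avoiding f g \<inter> levels_upto f 0 = {[]}"
    by (auto simp: avoiding_def mem_levels_upto mem_nodes)
  with True show ?thesis by (simp add: subtrees_def)
next
  case False
  let ?s = "avoiding f g \<inter> levels_upto f k"
  have down: "\<rho> \<in> ?s" if mem: "\<eta> \<in> ?s" and "prefix \<rho> \<eta>" for \<eta> \<rho>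
  proof -
    obtain ys where \<eta>: "\<eta> = \<rho> @ ys" using \<open>prefix \<rho> \<eta>\<close> by (auto simp: prefix_def)
    have "\<rho> ! i \<le> f i \<and> \<rho> ! i \<noteq> g (take i \<rho>)" if "i < length \<rho>" for i
    proof -
      have "i < length \<eta>" "\<eta> ! i = \<rho> ! i" "take i \<eta> = take i \<rho>"
        using that by (simp_all add: \<eta> nth_append)
      with mem show ?thesis by (fastforce simp: avoiding_def mem_nodes)
    qed
    with mem \<eta> show ?thesis by (auto simp: avoiding_def mem_levels_upto mem_nodes)
  qed
  have snoc_s: "\<eta> @ [l] \<in> ?s \<longleftrightarrow>
      \<eta> \<in> ?s \<and> length \<eta> < k \<and> l \<le> f (length \<eta>) \<and> l \<noteq> g \<eta>" for \<eta> l
    by (auto simp: snoc_mem_avoiding mem_levels_upto snoc_mem_nodes)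
  have child: "\<exists>l. \<eta> @ [l] \<in> ?s" if "\<eta> \<in> ?s" "length \<eta> < k" for \<eta>
  proof -
    have "(if g \<eta> = 0 then 1 else 0) \<le> f (length \<eta>)" using pos[of "length \<eta>"] by auto
    with that show ?thesis
      unfolding snoc_s by (intro exI[of _ "if g \<eta> = 0 then 1 else 0"]) auto
  qed
  have thin: "thin_subtree f k ?s"
    unfolding thin_subtree_def
  proof (intro conjI ballI allI impI)
    have "[] \<in> ?s" by (simp add: avoiding_def mem_levels_upto mem_nodes)
    then show "?s \<noteq> {}" by blast
    show "\<eta> \<in> level f k" if "\<eta> \<in> ?s" "\<forall>\<rho>\<in>?s. prefix \<eta> \<rho> \<longrightarrow> \<rho> = \<eta>" for \<eta>
    proof -
      have "\<not> length \<eta> < k"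
      proof
        assume "length \<eta> < k"
        from child[OF that(1) this] obtain l where "\<eta> @ [l] \<in> ?s" by blast
        moreover have "prefix \<eta> (\<eta> @ [l])" by simp
        ultimately show False using that(2) by fastforce
      qed
      with that(1) show ?thesis by (auto simp: mem_level mem_levels_upto)
    qed
    show "\<not> {\<rho> @ [l] |l. l \<le> f (length \<rho>)} \<subseteq> ?s" for \<rho>
      using g[of \<rho>] snoc_s[of \<rho> "g \<rho>"] by blast
    show "?s \<subseteq> levels_upto f k" by blast
    show "\<rho> \<in> ?s" if "\<eta> \<in> ?s" "prefix \<rho> \<eta>" for \<eta> \<rho> by (rule down[OF that])
  qed
  have "s' = ?s" if s': "thin_subtree f k s'" "?s \<subseteq> s'" for s'
  proof -
    have "\<eta> \<in> ?s" if "\<eta> \<in> s'" for \<eta>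
      using that
    proof (induction \<eta> rule: rev_induct)
      case Nil
      show ?case by (auto simp: avoiding_def mem_levels_upto mem_nodes)
    next
      case (snoc l \<eta>)
      have \<eta>: "\<eta> \<in> ?s" using snoc s'(1) unfolding thin_subtree_def by (meson prefixI)
      have "\<eta> @ [l] \<in> levels_upto f k" using snoc.prems s'(1) unfolding thin_subtree_def by blast
      then have l: "length \<eta> < k" "l \<le> f (length \<eta>)"
        by (auto simp: mem_levels_upto snoc_mem_nodes)
      have "l \<noteq> g \<eta>"
      proof
        assume "l = g \<eta>"
        then have "\<eta> @ [i] \<in> s'" if "i \<le> f (length \<eta>)" for i
          using that snoc.prems \<eta> l(1) s'(2) snoc_s[of \<eta> i] by (cases "i = g \<eta>") blast+
        moreover have "\<eta> \<in> levels_upto f k" using \<eta> by blast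
        ultimately show False using s'(1) unfolding thin_subtree_def by blast
      qed
      with \<eta> l show ?case by (simp add: snoc_mem_avoiding mem_levels_upto snoc_mem_nodes)
    qed
    with s' show ?thesis by blast
  qed
  with thin False show ?thesis by (simp add: subtrees_def)
qed

lemma subtree_le_avoiding:
  assumes pos: "\<And>n. f n \<noteq> 0" and g: "\<And>\<rho>. g \<rho> \<le> f (length \<rho>)"
    and s: "s \<in> subtrees f k" "s \<subseteq> avoiding f g"
  shows "s = avoiding f g \<inter> levels_upto f k"
proof (cases "k = 0")
  case True
  then have "s = {[]}" using s(1) by (simp add: subtrees_def)
  with True show ?thesis
    by (auto simp: avoiding_def mem_levels_upto mem_nodes)
next
  case False
  have "s \<subseteq> levels_upto f k" using s(1) False by (auto simp: subtrees_def thin_subtree_def)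
  moreover have "thin_subtree f k (avoiding f g \<inter> levels_upto f k)"
    using avoiding_mem_subtrees[of f g k, OF pos g] False by (simp add: subtrees_def)
  ultimately show ?thesis using s False by (auto simp: subtrees_def)
qed

text \<open>A finite family of branches, together with one element of \<open>Q\<close> for each thin subfamily that
  is related to exactly that subfamily, is a model of the universal theory. The element
  \<open>q u\<close> lies in those \<open>Q\<^sub>s\<close> for which \<open>s\<close> is contained in a fixed tree that carries the
  branches in \<open>u\<close> and lacks exactly one successor of every node; thinness of \<open>u\<close> leaves room for
  such a tree.\<close>

lemma thin_families_realised_in_T0_model:
  fixes B :: "'a \<Rightarrow> nat \<Rightarrow> nat"
  assumes inf: "infinite (UNIV :: 'm set)" and pos: "\<And>n. f n \<noteq> 0"
    and w: "finite w" and B: "\<And>\<alpha> k. \<alpha> \<in> w \<Longrightarrow> B \<alpha> k \<le> f k"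
  shows "\<exists>(M :: (sym, 'm) struct) a. models M (T0 f) \<and> (\<forall>\<alpha>\<in>w. a \<alpha> \<in> univ M) \<and>
    (\<forall>\<alpha>\<in>w. \<forall>k. interp M (Pn (map (B \<alpha>) [0..<k])) [a \<alpha>]) \<and>
    (\<forall>u\<subseteq>w. thin_branches f B u \<longrightarrow> (\<exists>x\<in>univ M. \<forall>\<alpha>\<in>u. interp M R [x, a \<alpha>]))"
proof -
  let ?U = "w <+> Pow w"
  obtain Z :: "'m set" where Z: "finite Z" "card Z = card ?U"
    using infinite_arbitrarily_large[OF inf] by blast
  then obtain j :: "'a + 'a set \<Rightarrow> 'm" where j: "inj_on j ?U"
    by (metis card_le_inj finite_Plus finite_Pow_iff order_refl w)
  define a where "a = (\<lambda>\<alpha>. j (Inl \<alpha>))"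
  define q where "q = (\<lambda>u. j (Inr u))"
  define Th where "Th = {u. u \<subseteq> w \<and> thin_branches f B u}"
  have a_inj: "a \<alpha> = a \<beta> \<longleftrightarrow> \<alpha> = \<beta>" if "\<alpha> \<in> w" "\<beta> \<in> w" for \<alpha> \<beta>
    using inj_onD[OF j, of "Inl \<alpha>" "Inl \<beta>"] that by (auto simp: a_def)
  have q_inj: "q u = q v \<longleftrightarrow> u = v" if "u \<in> Th" "v \<in> Th" for u v
    using inj_onD[OF j, of "Inr u" "Inr v"] that by (auto simp: q_def Th_def)
  have aq: "a \<alpha> \<noteq> q u" "q u \<noteq> a \<alpha>" if "\<alpha> \<in> w" "u \<in> Th" for \<alpha> u
    using inj_onD[OF j, of "Inl \<alpha>" "Inr u"] inj_onD[OF j, of "Inr u" "Inl \<alpha>"] that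
    by (auto simp: a_def q_def Th_def)
  define g where "g = (\<lambda>u \<rho>. SOME l. l \<le> f (length \<rho>) \<and>
    (\<forall>\<alpha>\<in>u. map (B \<alpha>) [0..<Suc (length \<rho>)] \<noteq> \<rho> @ [l]))"
  have g: "g u \<rho> \<le> f (length \<rho>) \<and> (\<forall>\<alpha>\<in>u. map (B \<alpha>) [0..<Suc (length \<rho>)] \<noteq> \<rho> @ [g u \<rho>])"
    if "u \<in> Th" for u \<rho>
    unfolding g_def by (rule someI_ex) (use that in \<open>auto simp: Th_def thin_branches_def\<close>)
  have branch_node: "map (B \<alpha>) [0..<k] \<in> level f k" if "\<alpha> \<in> w" for \<alpha> k
    using B that by (simp add: level_def)
  have branch: "map (B \<alpha>) [0..<k] \<in> avoiding f (g u)" if "u \<in> Th" "\<alpha> \<in> u" for u \<alpha> k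
  proof -
    have "B \<alpha> i \<noteq> g u (map (B \<alpha>) [0..<i])" for i
      using g[OF that(1), of "map (B \<alpha>) [0..<i]"] that(2) by fastforce
    moreover have "\<alpha> \<in> w" using that by (auto simp: Th_def)
    ultimately show ?thesis
      using branch_node[of \<alpha> k] by (simp add: avoiding_def mem_level take_map)
  qed
  have sub: "s = avoiding f (g u) \<inter> levels_upto f k"
    if "u \<in> Th" "s \<in> subtrees f k" "s \<subseteq> avoiding f (g u)" for u s k
    by (rule subtree_le_avoiding) (use pos g that in auto)
  define M :: "(sym, 'm) struct" where "M = \<lparr>univ = a ` w \<union> q ` Th,
    interp = (\<lambda>r xs. case r of
       P \<Rightarrow> hd xs \<in> a ` w
     | Q \<Rightarrow> hd xs \<in> q ` Th
     | R \<Rightarrow> (\<exists>u\<in>Th. \<exists>\<alpha>\<in>u. xs = [q u, a \<alpha>])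
     | Pn \<eta> \<Rightarrow> (\<exists>\<alpha>\<in>w. hd xs = a \<alpha> \<and> \<eta> = map (B \<alpha>) [0..<length \<eta>])
     | Qs s \<Rightarrow> (\<exists>u\<in>Th. hd xs = q u \<and> s \<subseteq> avoiding f (g u)))\<rparr>"
  have univ: "univ M = a ` w \<union> q ` Th" by (simp add: M_def)
  have extP: "ext M P = a ` w" and extQ: "ext M Q = q ` Th"
    by (auto simp: M_def ext_def)
  have extPn: "ext M (Pn \<eta>) = {a \<alpha> |\<alpha>. \<alpha> \<in> w \<and> \<eta> = map (B \<alpha>) [0..<length \<eta>]}" for \<eta>
    by (auto simp: M_def ext_def)
  have extQs: "ext M (Qs s) = {q u |u. u \<in> Th \<and> s \<subseteq> avoiding f (g u)}" for s
    by (auto simp: M_def ext_def)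
  have R: "interp M R [x, y] \<longleftrightarrow> (\<exists>u\<in>Th. \<exists>\<alpha>\<in>u. x = q u \<and> y = a \<alpha>)" for x y
    by (auto simp: M_def)
  have Th_w: "\<alpha> \<in> w" if "u \<in> Th" "\<alpha> \<in> u" for u \<alpha> using that by (auto simp: Th_def)
  have branch_prefix: "\<eta> = map (B \<alpha>) [0..<length \<eta>]"
    if "prefix \<eta> \<eta>'" "\<eta>' = map (B \<alpha>) [0..<length \<eta>']" for \<eta> \<eta>' \<alpha>
  proof -
    have "\<eta> = take (length \<eta>) \<eta>'" "length \<eta> \<le> length \<eta>'"
      using that(1) by (auto simp: prefix_def)
    then show ?thesis by (subst (asm) that(2)) (simp add: take_map)
  qed
  have empty: "{} \<in> Th" by (auto simp: Th_def thin_branches_def)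
  show ?thesis
  proof (intro exI[of _ M] exI[of _ a] conjI ballI allI impI)
    show "models M (T0 f)"
      unfolding models_T0_iff
    proof (intro conjI allI ballI impI)
      show "univ M \<noteq> {}" using empty by (auto simp: univ)
      show "ext M P \<union> ext M Q = univ M" "ext M P \<inter> ext M Q = {}"
        using aq by (auto simp: extP extQ univ)
    next
      fix k
      show "partitions (level f k) (\<lambda>\<eta>. ext M (Pn \<eta>)) (ext M P)"
        unfolding partitions_def
      proof (intro conjI ballI impI)
        show "(\<Union>\<eta>\<in>level f k. ext M (Pn \<eta>)) = ext M P"
        proof
          show "(\<Union>\<eta>\<in>level f k. ext M (Pn \<eta>)) \<subseteq> ext M P" unfolding extP extPn by blast
          have "a \<alpha> \<in> ext M (Pn (map (B \<alpha>) [0..<k]))" if "\<alpha> \<in> w" for \<alpha>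
            using that unfolding extPn by auto
          then show "ext M P \<subseteq> (\<Union>\<eta>\<in>level f k. ext M (Pn \<eta>))"
            unfolding extP using branch_node by blast
        qed
        show "ext M (Pn \<eta>) \<inter> ext M (Pn \<eta>') = {}"
          if "\<eta> \<in> level f k" "\<eta>' \<in> level f k" "\<eta> \<noteq> \<eta>'" for \<eta> \<eta>'
        proof -
          have "length \<eta> = length \<eta>'" using that by (simp add: mem_level)
          then show ?thesis
            using that(3) a_inj unfolding extPn by (smt (verit) disjoint_iff mem_Collect_eq)
        qed
      qed
      show "partitions (subtrees f k) (\<lambda>s. ext M (Qs s)) (ext M Q)"
        unfolding partitions_def
      proof (intro conjI ballI impI)
        have "\<exists>s\<in>subtrees f k. q u \<in> ext M (Qs s)" if "u \<in> Th" for u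
          using avoiding_mem_subtrees[of f "g u" k] g[OF that] pos that unfolding extQs by blast
        then show "(\<Union>s\<in>subtrees f k. ext M (Qs s)) = ext M Q"
          unfolding extQ by (auto simp: extQs)
        show "ext M (Qs s) \<inter> ext M (Qs s') = {}"
          if "s \<in> subtrees f k" "s' \<in> subtrees f k" "s \<noteq> s'" for s s'
        proof -
          have "u = v \<longrightarrow> \<not> s' \<subseteq> avoiding f (g v)"
            if "u \<in> Th" "s \<subseteq> avoiding f (g u)" for u v
            using sub[OF that(1) _ that(2)] sub[OF that(1), of s' k]
              \<open>s \<in> subtrees f k\<close> \<open>s' \<in> subtrees f k\<close> \<open>s \<noteq> s'\<close> by blast
          then show ?thesis
            using q_inj unfolding extQs by (smt (verit) disjoint_iff mem_Collect_eq)
        qed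
      qed
    next
      fix \<eta> \<eta>' :: "nat list" assume "prefix \<eta> \<eta>'"
      then show "ext M (Pn \<eta>') \<subseteq> ext M (Pn \<eta>)"
        using branch_prefix unfolding extPn by blast
    next
      fix s s' :: "nat list set" assume "s \<subseteq> s'"
      then show "ext M (Qs s') \<subseteq> ext M (Qs s)" unfolding extQs by blast
    next
      fix b y assume "interp M R [b, y]"
      then show "b \<in> ext M Q" "y \<in> ext M P" using Th_w by (auto simp: R extP extQ)
    next
      fix k \<eta> b
      assume \<eta>: "\<eta> \<in> level f k" and b: "\<forall>l\<le>f k. b l \<in> ext M (Pn (\<eta> @ [l]))"
      show "\<not> (\<exists>x\<in>ext M Q. \<forall>l\<le>f k. interp M R [x, b l])"
      proof
        assume "\<exists>x\<in>ext M Q. \<forall>l\<le>f k. interp M R [x, b l]"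
        then obtain u where u: "u \<in> Th" "\<forall>l\<le>f k. interp M R [q u, b l]" by (auto simp: extQ)
        have "\<exists>\<alpha>\<in>u. map (B \<alpha>) [0..<Suc (length \<eta>)] = \<eta> @ [l]" if l: "l \<le> f k" for l
        proof -
          obtain v \<alpha> where v: "v \<in> Th" "\<alpha> \<in> v" "q u = q v" "b l = a \<alpha>"
            using u(2) l unfolding R by blast
          then have \<alpha>: "\<alpha> \<in> u" "b l = a \<alpha>" using q_inj[OF u(1) v(1)] by auto
          obtain \<beta> where \<beta>: "\<beta> \<in> w" "b l = a \<beta>" "\<eta> @ [l] = map (B \<beta>) [0..<length (\<eta> @ [l])]"
            using b l unfolding extPn by blast
          have "\<beta> = \<alpha>" using a_inj[OF \<beta>(1) Th_w[OF u(1) \<alpha>(1)]] \<alpha>(2) \<beta>(2) by simp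
          then have "map (B \<alpha>) [0..<Suc (length \<eta>)] = \<eta> @ [l]"
            using \<beta>(3) by (simp del: upt_Suc)
          with \<alpha>(1) show ?thesis by blast
        qed
        moreover have "length \<eta> = k" using \<eta> by (simp add: mem_level)
        ultimately show False using u(1) unfolding Th_def thin_branches_def by blast
      qed
    next
      fix k s \<eta> b y
      assume s: "s \<in> subtrees f k" and \<eta>: "\<eta> \<in> level f k" and b: "b \<in> ext M (Qs s)"
        and y: "y \<in> ext M (Pn \<eta>)" and r: "interp M R [b, y]"
      obtain u where u: "u \<in> Th" "b = q u" "s \<subseteq> avoiding f (g u)" using b by (auto simp: extQs)
      obtain \<alpha> where \<alpha>: "\<alpha> \<in> w" "y = a \<alpha>" "\<eta> = map (B \<alpha>) [0..<length \<eta>]"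
        using y unfolding extPn by blast
      obtain v \<beta> where v: "v \<in> Th" "\<beta> \<in> v" "b = q v" "y = a \<beta>" using r unfolding R by blast
      have "\<alpha> \<in> u"
        using q_inj[OF u(1) v(1)] a_inj[OF \<alpha>(1) Th_w[OF v(1,2)]] u(2) \<alpha>(2) v by simp
      from branch[OF u(1) this, of "length \<eta>"] have "\<eta> \<in> avoiding f (g u)"
        unfolding \<alpha>(3)[symmetric] .
      then show "\<eta> \<in> s" using \<eta> sub[OF u(1) s u(3)] by (auto simp: mem_level mem_levels_upto)
    qed
    show "a \<alpha> \<in> univ M" if "\<alpha> \<in> w" for \<alpha> using that by (simp add: univ)
    show "interp M (Pn (map (B \<alpha>) [0..<k])) [a \<alpha>]" if "\<alpha> \<in> w" for \<alpha> k
      using that by (auto simp: M_def)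
    show "\<exists>x\<in>univ M. \<forall>\<alpha>\<in>u. interp M R [x, a \<alpha>]" if "u \<subseteq> w" "thin_branches f B u" for u
      using that by (intro bexI[of _ "q u"]) (auto simp: R univ Th_def)
  qed
qed

text \<open>The type of the configuration of parameters decides consistency: an embedding of the
  finite model into a model of the completion gives the witnesses for thin subfamilies, and the
  universal theory forbids witnesses for the others.\<close>

lemma model_completion_thin:
  fixes B :: "'a \<Rightarrow> nat \<Rightarrow> nat"
  assumes mc: "model_completion TYPE('m) (vocab f) (T0 f) T"
    and inf: "infinite (UNIV :: 'm set)" and pos: "\<And>n. f n \<noteq> 0"
    and w: "finite w" and B: "\<And>\<alpha> k. \<alpha> \<in> w \<Longrightarrow> B \<alpha> k \<le> f k"
  shows "\<exists>(N :: (sym, 'm) struct) a. models N T \<and> (\<forall>\<alpha>\<in>w. a \<alpha> \<in> univ N) \<and>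
    (\<forall>u\<subseteq>w. (\<exists>x\<in>univ N. \<forall>\<alpha>\<in>u. interp N R [x, a \<alpha>]) \<longleftrightarrow> thin_branches f B u)"
proof -
  obtain M :: "(sym, 'm) struct" and a where "models M (T0 f) \<and> (\<forall>\<alpha>\<in>w. a \<alpha> \<in> univ M) \<and>
      (\<forall>\<alpha>\<in>w. \<forall>k. interp M (Pn (map (B \<alpha>) [0..<k])) [a \<alpha>]) \<and>
      (\<forall>u\<subseteq>w. thin_branches f B u \<longrightarrow> (\<exists>x\<in>univ M. \<forall>\<alpha>\<in>u. interp M R [x, a \<alpha>]))"
    using thin_families_realised_in_T0_model[OF inf _ w, of f B] pos B by blast
  then have M: "models M (T0 f)" and a: "\<And>\<alpha>. \<alpha> \<in> w \<Longrightarrow> a \<alpha> \<in> univ M"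
    and Pn: "\<And>\<alpha> k. \<alpha> \<in> w \<Longrightarrow> interp M (Pn (map (B \<alpha>) [0..<k])) [a \<alpha>]"
    and R: "\<And>u. u \<subseteq> w \<Longrightarrow> thin_branches f B u \<Longrightarrow> \<exists>x\<in>univ M. \<forall>\<alpha>\<in>u. interp M R [x, a \<alpha>]"
    by simp_all
  obtain N :: "(sym, 'm) struct" and e where N: "models N T" and e: "embedding (vocab f) e M N"
    using mc M unfolding model_completion_def by blast
  have N0: "models N (T0 f)" using mc N unfolding model_completion_def by blast
  have eu: "e x \<in> univ N" if "x \<in> univ M" for x using e that unfolding embedding_def by blast
  have pres: "interp N r (map e xs) \<longleftrightarrow> interp M r xs"
    if "vocab f r = Some (length xs)" "set xs \<subseteq> univ M" for r xs
    using e that unfolding embedding_def by blast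
  have "(\<exists>x\<in>univ N. \<forall>\<alpha>\<in>u. interp N R [x, e (a \<alpha>)]) \<longleftrightarrow> thin_branches f B u"
    if u: "u \<subseteq> w" for u
  proof
    assume "thin_branches f B u"
    from R[OF u this] obtain x where x: "x \<in> univ M" "\<forall>\<alpha>\<in>u. interp M R [x, a \<alpha>]" by blast
    have "interp N R [e x, e (a \<alpha>)]" if "\<alpha> \<in> u" for \<alpha>
      using pres[of R "[x, a \<alpha>]"] x a u that by auto
    then show "\<exists>x\<in>univ N. \<forall>\<alpha>\<in>u. interp N R [x, e (a \<alpha>)]" using eu x(1) by blast
  next
    assume "\<exists>x\<in>univ N. \<forall>\<alpha>\<in>u. interp N R [x, e (a \<alpha>)]"
    then obtain x where x: "x \<in> univ N" "\<forall>\<alpha>\<in>u. interp N R [x, e (a \<alpha>)]" by blast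
    show "thin_branches f B u"
    proof (rule ccontr)
      assume "\<not> thin_branches f B u"
      then obtain \<rho> where "\<forall>l\<le>f (length \<rho>). \<exists>\<alpha>\<in>u. map (B \<alpha>) [0..<Suc (length \<rho>)] = \<rho> @ [l]"
        unfolding thin_branches_def by blast
      then obtain \<gamma> where \<gamma>: "\<And>l. l \<le> f (length \<rho>) \<Longrightarrow>
          \<gamma> l \<in> u \<and> map (B (\<gamma> l)) [0..<Suc (length \<rho>)] = \<rho> @ [l]"
        by metis
      have node: "\<rho> @ [l] \<in> nodes f" if l: "l \<le> f (length \<rho>)" for l
      proof -
        have "map (B (\<gamma> l)) [0..<k] \<in> level f k" for k
          using B \<gamma>[OF l] u by (auto simp: level_def)
        from this[of "Suc (length \<rho>)"]
        have "map (B (\<gamma> l)) [0..<Suc (length \<rho>)] \<in> level f (Suc (length \<rho>))" .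
        with \<gamma>[OF l] show ?thesis by (simp add: mem_level del: upt_Suc)
      qed
      have "\<rho> \<in> level f (length \<rho>)" using node[of 0] by (simp add: snoc_mem_nodes mem_level)
      moreover have "e (a (\<gamma> l)) \<in> ext N (Pn (\<rho> @ [l]))" if l: "l \<le> f (length \<rho>)" for l
      proof -
        have "interp M (Pn (\<rho> @ [l])) [a (\<gamma> l)]" using Pn[of "\<gamma> l"] \<gamma>[OF l] u by (metis subsetD)
        moreover have "a (\<gamma> l) \<in> univ M" using a \<gamma>[OF l] u by blast
        ultimately show ?thesis
          using pres[of "Pn (\<rho> @ [l])" "[a (\<gamma> l)]"] node[OF l] eu by (simp add: ext_def)
      qed
      moreover have "interp N R [x, e (a (\<gamma> l))]" if l: "l \<le> f (length \<rho>)" for l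
        using x(2) \<gamma>[OF l] by blast
      moreover have "x \<in> ext N Q"
      proof -
        have "e (a (\<gamma> 0)) \<in> univ N" using a eu \<gamma>[of 0] u by blast
        then show ?thesis
          using N0 x(1) \<open>\<And>l. l \<le> f (length \<rho>) \<Longrightarrow> interp N R [x, e (a (\<gamma> l))]\<close>[of 0]
          unfolding models_T0_iff by blast
      qed
      ultimately show False
        using N0 unfolding models_T0_iff by (elim conjE) meson
    qed
  qed
  with N a eu show ?thesis by (intro exI[of _ N] exI[of _ "\<lambda>\<alpha>. e (a \<alpha>)"]) auto
qed


section \<open>Boolean values of properties of generic points\<close>

definition forces :: "('i \<rightharpoonup> 'u) \<Rightarrow> (('i \<Rightarrow> 'u) \<Rightarrow> bool) \<Rightarrow> bool" where
  "forces h G \<longleftrightarrow> (\<forall>g. h \<subseteq>\<^sub>m Some \<circ> g \<longrightarrow> G g)"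

text \<open>The completion of the free Boolean algebra is the algebra of regular open sets of the
  product space \<open>'i \<Rightarrow> 'u\<close> with \<open>'u\<close> discrete. There the following is the regular open set generated
  by the interior of \<open>G\<close>; a property that depends on finitely many coordinates only is clopen
  and hence its own value.\<close>

definition bool_value ::
  "(('i \<rightharpoonup> 'u) \<Rightarrow> 'b::{boolean_algebra, complete_lattice}) \<Rightarrow> (('i \<Rightarrow> 'u) \<Rightarrow> bool) \<Rightarrow> 'b" where
  "bool_value X G = Sup {X h |h. finite (dom h) \<and> forces h G}"

lemma bool_value_mono: "(\<And>g. G g \<Longrightarrow> H g) \<Longrightarrow> bool_value X G \<le> bool_value X H"
  unfolding bool_value_def forces_def by (rule Sup_subset_mono) blast

lemma ultrafilter_upward: "ultrafilter D \<Longrightarrow> a \<in> D \<Longrightarrow> a \<le> b \<Longrightarrow> b \<in> D"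
  unfolding ultrafilter_def by blast

lemma le_bool_value: "finite (dom h) \<Longrightarrow> forces h G \<Longrightarrow> X h \<le> bool_value X G"
  unfolding bool_value_def by (rule Sup_upper) blast

lemma forces_antimono: "forces h G \<Longrightarrow> h \<subseteq>\<^sub>m h' \<Longrightarrow> forces h' G"
  unfolding forces_def using map_le_trans by blast

lemma map_le_total: "\<exists>g. h \<subseteq>\<^sub>m Some \<circ> g"
  by (rule exI[of _ "\<lambda>i. the (h i)"]) (auto simp: map_le_def)

lemma restrict_total_le_iff: "(Some \<circ> g) |` I \<subseteq>\<^sub>m Some \<circ> g' \<longleftrightarrow> (\<forall>i\<in>I. g' i = g i)"
  by (auto simp: map_le_def restrict_map_def dom_def)

lemma dom_restrict_total: "dom ((Some \<circ> g) |` I) = I"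
  by (auto simp: restrict_map_def split: if_splits)

definition depends_on :: "(('i \<Rightarrow> 'u) \<Rightarrow> bool) \<Rightarrow> 'i set \<Rightarrow> bool" where
  "depends_on G J \<longleftrightarrow> (\<forall>g g'. (\<forall>i\<in>J. g i = g' i) \<longrightarrow> G g = G g')"

lemma forces_restrict:
  assumes "depends_on G J" "J \<subseteq> I"
  shows "forces ((Some \<circ> g) |` I) G \<longleftrightarrow> G g"
  using assms unfolding forces_def restrict_total_le_iff depends_on_def by (metis subsetD)

context
  fixes X :: "('i \<rightharpoonup> 'u) \<Rightarrow> 'b::{boolean_algebra, complete_lattice}"
  assumes X: "free_completion X"
begin

lemma condition_nonzero: "finite (dom h) \<Longrightarrow> X h \<noteq> bot"
  using X unfolding free_completion_def by blast

lemma condition_antimono: "finite (dom h') \<Longrightarrow> h \<subseteq>\<^sub>m h' \<Longrightarrow> X h' \<le> X h"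
  using X unfolding free_completion_def by (metis finite_subset map_le_implies_dom_le)

lemma condition_le_imp_extends:
  "finite (dom h) \<Longrightarrow> finite (dom h') \<Longrightarrow> X h' \<le> X h \<Longrightarrow> h \<subseteq>\<^sub>m h'"
  using X unfolding free_completion_def by blast

lemma conditions_meet:
  assumes h: "finite (dom h)" "finite (dom h')" "inf (X h) (X h') \<noteq> bot"
  shows "\<exists>g. h \<subseteq>\<^sub>m Some \<circ> g \<and> h' \<subseteq>\<^sub>m Some \<circ> g"
proof -
  have eq: "inf (X h) (X h') = (if \<forall>i \<in> dom h \<inter> dom h'. h i = h' i then X (h ++ h') else bot)"
    using X h(1,2) unfolding free_completion_def by blast
  then have "\<forall>i \<in> dom h \<inter> dom h'. h i = h' i" using h(3) by (auto split: if_splits)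
  then have "h i = (h ++ h') i" if "i \<in> dom h" for i
    using that by (cases "i \<in> dom h'") (simp_all add: map_add_dom_app_simps)
  then have "h \<subseteq>\<^sub>m h ++ h'" unfolding map_le_def by blast
  moreover have "h' \<subseteq>\<^sub>m h ++ h'" by simp
  ultimately show ?thesis using map_le_total map_le_trans by blast
qed

text \<open>The condition is given as the restriction of a total function, so that whether it forces a
  property supported by its domain can be read off at this one point
  (\<open>forces_restrict\<close>).\<close>

lemma exists_condition_below:
  assumes "b \<noteq> bot" "finite J"
  shows "\<exists>g I. finite I \<and> J \<subseteq> I \<and> X ((Some \<circ> g) |` I) \<le> b"
proof -
  obtain h where h: "finite (dom h)" "X h \<le> b"
    using X assms(1) unfolding free_completion_def by blast
  obtain g where g: "h \<subseteq>\<^sub>m Some \<circ> g" using map_le_total by blast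
  let ?I = "dom h \<union> J"
  have "finite ?I" using h assms by simp
  moreover have "h \<subseteq>\<^sub>m (Some \<circ> g) |` ?I" using g by (auto simp: map_le_def)
  then have "X ((Some \<circ> g) |` ?I) \<le> X h"
    by (intro condition_antimono) (use calculation in \<open>simp_all only: dom_restrict_total\<close>)
  ultimately show ?thesis using h(2) order_trans by (intro exI[of _ g] exI[of _ ?I]) auto
qed

lemma bool_value_eq_bot_below:
  assumes "finite (dom h)" "forces h (\<lambda>g. \<not> G g)"
  shows "inf (X h) (bool_value X G) = bot"
proof -
  have "X h' \<le> - X h" if h': "finite (dom h')" "forces h' G" for h'
  proof -
    have "inf (X h) (X h') = bot"
      using conditions_meet[OF assms(1) h'(1)] assms(2) h'(2) unfolding forces_def by blast
    then show ?thesis by (simp add: inf_shunt inf.commute[of "X h"])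
  qed
  then have "bool_value X G \<le> - X h"
    unfolding bool_value_def by (intro Sup_least) blast
  then show ?thesis by (simp add: inf_shunt inf.commute[of "X h"])
qed

lemma exists_forcing_condition:
  assumes "b \<noteq> bot" "b \<le> bool_value X G"
  shows "\<exists>h. finite (dom h) \<and> X h \<le> b \<and> forces h G"
proof -
  have "\<exists>h. finite (dom h) \<and> forces h G \<and> inf b (X h) \<noteq> bot"
  proof (rule ccontr)
    assume "\<not> ?thesis"
    then have "bool_value X G \<le> - b"
      unfolding bool_value_def by (intro Sup_least) (auto simp: inf_shunt inf.commute[of b])
    with assms(2) have "b \<le> - b" by (rule order_trans)
    then have "b = bot" by (metis inf.absorb1 inf_compl_bot)
    with assms(1) show False ..
  qed
  then obtain h where h: "finite (dom h)" "forces h G" "inf b (X h) \<noteq> bot" by blast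
  obtain h' where h': "finite (dom h')" "X h' \<le> inf b (X h)"
    using X h(3) unfolding free_completion_def by blast
  then have "h \<subseteq>\<^sub>m h'" by (intro condition_le_imp_extends h) auto
  then have "forces h' G" using h(2) forces_antimono by blast
  with h' show ?thesis by auto
qed

lemma le_bool_valueI:
  assumes "\<And>h. finite (dom h) \<Longrightarrow> X h \<le> b \<Longrightarrow>
    \<exists>h'. finite (dom h') \<and> X h' \<le> X h \<and> forces h' G"
  shows "b \<le> bool_value X G"
proof (rule ccontr)
  assume "\<not> ?thesis"
  then have "inf b (- bool_value X G) \<noteq> bot" by (simp add: inf_shunt)
  then obtain h where h: "finite (dom h)" "X h \<le> inf b (- bool_value X G)"
    using X unfolding free_completion_def by blast
  with assms obtain h' where h': "finite (dom h')" "X h' \<le> X h" "forces h' G"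
    by (meson le_inf_iff)
  have "X h' \<le> bool_value X G" "X h' \<le> - bool_value X G"
    using le_bool_value[OF h'(1,3)] h h' by (auto intro: order_trans)
  then have "X h' \<le> bot" by (metis inf_compl_bot le_inf_iff)
  with condition_nonzero[OF h'(1)] show False by (simp add: bot_unique)
qed

lemma bool_value_conj:
  "inf (bool_value X G) (bool_value X H) \<le> bool_value X (\<lambda>g. G g \<and> H g)"
proof (rule le_bool_valueI)
  fix h assume h: "finite (dom h)" "X h \<le> inf (bool_value X G) (bool_value X H)"
  from h obtain h1 where h1: "finite (dom h1)" "X h1 \<le> X h" "forces h1 G"
    using exists_forcing_condition[of "X h" G] condition_nonzero by (meson le_inf_iff)
  have "X h1 \<le> bool_value X H" using h h1 by (meson le_inf_iff order_trans)
  with h1 obtain h2 where h2: "finite (dom h2)" "X h2 \<le> X h1" "forces h2 H"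
    using exists_forcing_condition[of "X h1" H] condition_nonzero by meson
  have "h1 \<subseteq>\<^sub>m h2" using condition_le_imp_extends h1 h2 by blast
  then have "forces h2 (\<lambda>g. G g \<and> H g)"
    using h1(3) h2(3) forces_antimono unfolding forces_def by blast
  with h1 h2 show "\<exists>h'. finite (dom h') \<and> X h' \<le> X h \<and> forces h' (\<lambda>g. G g \<and> H g)"
    by (meson order_trans)
qed

lemma bool_value_not:
  assumes "finite J" "depends_on G J"
  shows "- bool_value X G \<le> bool_value X (\<lambda>g. \<not> G g)"
proof (rule le_bool_valueI)
  fix h assume h: "finite (dom h)" "X h \<le> - bool_value X G"
  obtain g I where g: "finite I" "J \<subseteq> I" "X ((Some \<circ> g) |` I) \<le> X h"
    using exists_condition_below[OF condition_nonzero[OF h(1)] assms(1)] by blast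
  have fin: "finite (dom ((Some \<circ> g) |` I))" using g(1) by (simp only: dom_restrict_total)
  have "\<not> G g"
  proof
    assume "G g"
    then have "X ((Some \<circ> g) |` I) \<le> bool_value X G"
      using le_bool_value[OF fin] forces_restrict[OF assms(2) g(2)] by blast
    moreover have "X ((Some \<circ> g) |` I) \<le> - bool_value X G" using g(3) h(2) by (rule order_trans)
    ultimately have "X ((Some \<circ> g) |` I) \<le> bot" by (metis inf_compl_bot le_inf_iff)
    with condition_nonzero[OF fin] show False by (simp add: bot_unique)
  qed
  moreover have "depends_on (\<lambda>g. \<not> G g) J" using assms(2) unfolding depends_on_def by metis
  ultimately have "forces ((Some \<circ> g) |` I) (\<lambda>g. \<not> G g)" using forces_restrict[OF _ g(2)] by blast
  with fin g(3) show "\<exists>h'. finite (dom h') \<and> X h' \<le> X h \<and> forces h' (\<lambda>g. \<not> G g)" by blast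
qed

context
  fixes D :: "'b set"
  assumes D: "ultrafilter D"
begin

lemma bool_value_decided:
  assumes "finite J" "depends_on G J"
  shows "bool_value X G \<in> D \<or> bool_value X (\<lambda>g. \<not> G g) \<in> D"
  using bool_value_not[OF assms] D unfolding ultrafilter_def by blast

lemma bool_value_ball:
  assumes "finite S" "\<And>p. p \<in> S \<Longrightarrow> bool_value X (G p) \<in> D"
  shows "bool_value X (\<lambda>g. \<forall>p\<in>S. G p g) \<in> D"
  using assms
proof (induction S rule: finite_induct)
  case empty
  have "depends_on (\<lambda>g. False) {}" by (simp add: depends_on_def)
  then show ?case
    using bool_value_decided[of "{}" "\<lambda>_. False"] ultrafilter_upward[OF D]
      bool_value_mono[of "\<lambda>_. False" "\<lambda>_. True" X]
    by auto
next
  case (insert p S)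
  have "inf (bool_value X (G p)) (bool_value X (\<lambda>g. \<forall>p\<in>S. G p g)) \<in> D"
    using insert D unfolding ultrafilter_def by blast
  from ultrafilter_upward[OF D this bool_value_conj] show ?case by simp
qed

text \<open>Each coordinate of the generic point is to be turned into a number \<open>\<le> f k\<close> so that every
  number remains possible while the ultrafilter believes that the number is \<open>0\<close>. For this \<open>'u\<close>
  is split into two infinite pieces; the piece chosen by the ultrafilter is labelled \<open>0\<close>, and
  the other one takes up all other labels.\<close>

lemma generic_labels:
  fixes f :: "nat \<Rightarrow> nat"
  assumes inf: "infinite (UNIV :: 'u set)" and pos: "\<And>n. f n \<noteq> 0"
  obtains label :: "'i \<Rightarrow> nat \<Rightarrow> 'u \<Rightarrow> nat"
  where "\<And>i k v. label i k v \<le> f k" and "\<And>i k l. l \<le> f k \<Longrightarrow> \<exists>v. label i k v = l"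
    and "\<And>i k. bool_value X (\<lambda>g. label i k (g i) = 0) \<in> D"
proof -
  obtain j :: "nat \<Rightarrow> 'u" where j: "inj j" using inf infinite_countable_subset by blast
  define num where "num = inv j"
  have num: "num (j n) = n" for n using j by (simp add: num_def)
  have "\<exists>p. bool_value X (\<lambda>g. even (num (g i)) = p) \<in> D" for i
  proof -
    have "depends_on (\<lambda>g. even (num (g i))) {i}" by (simp add: depends_on_def)
    from bool_value_decided[OF _ this] show ?thesis
      by (auto intro: exI[of _ True] exI[of _ False])
  qed
  then obtain p where p: "\<And>i. bool_value X (\<lambda>g. even (num (g i)) = p i) \<in> D" by metis
  define label where
    "label i k v = (if even (num v) = p i then 0 else min (num v div 2) (f k - 1) + 1)" for i k v
  show ?thesis
  proof
    show "label i k v \<le> f k" for i k v using pos[of k] by (auto simp: label_def)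
    show "\<exists>v. label i k v = l" if "l \<le> f k" for i k l
    proof (cases l)
      case 0
      have "label i k (j (if p i then 0 else 1)) = 0" by (simp add: label_def num)
      with 0 show ?thesis by blast
    next
      case (Suc m)
      have "label i k (j (if p i then 2 * m + 1 else 2 * m)) = l"
        using that Suc by (simp add: label_def num)
      then show ?thesis by blast
    qed
    show "bool_value X (\<lambda>g. label i k (g i) = 0) \<in> D" for i k
      using p[of i] by (simp add: label_def)
  qed
qed

end

end


section \<open>Large families of finite functions\<close>

text \<open>Large means of size not at most \<open>|'u|\<close>. The other sets form an ideal that is closed under
  unions of \<open>|'u|\<close> members, which is what pigeonhole and exhaustion arguments rest on.\<close>

lemma large_fibre:
  assumes inf: "infinite (UNIV :: 'u set)" and large: "\<not> |A| \<le>o |UNIV :: 'u set|"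
    and img: "|g ` A| \<le>o |UNIV :: 'u set|"
  shows "\<exists>c. \<not> |{a \<in> A. g a = c}| \<le>o |UNIV :: 'u set|"
proof (rule ccontr)
  assume "\<not> ?thesis"
  then have "|\<Union>c\<in>g ` A. {a \<in> A. g a = c}| \<le>o |UNIV :: 'u set|"
    by (intro card_of_UNION_ordLeq_infinite[OF inf img]) blast
  moreover have "(\<Union>c\<in>g ` A. {a \<in> A. g a = c}) = A" by blast
  ultimately show False using large by simp
qed

lemma finite_imp_small:
  "finite A \<Longrightarrow> infinite (UNIV :: 'u set) \<Longrightarrow> |A| \<le>o |UNIV :: 'u set|"
  by (rule ordLess_imp_ordLeq, rule finite_ordLess_infinite[OF card_of_Well_order card_of_Well_order])
    (simp_all add: Field_card_of)

lemma small_Un: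
  assumes "infinite (UNIV :: 'u set)" "|A| \<le>o |UNIV :: 'u set|" "|B| \<le>o |UNIV :: 'u set|"
  shows "|A \<union> B| \<le>o |UNIV :: 'u set|"
proof -
  have "|\<Union>i\<in>{A, B}. i| \<le>o |UNIV :: 'u set|"
    by (rule card_of_UNION_ordLeq_infinite[OF assms(1)])
      (use assms in \<open>auto intro: finite_imp_small\<close>)
  then show ?thesis by simp
qed

definition delta_family :: "('a \<Rightarrow> 'i \<rightharpoonup> 'u) \<Rightarrow> 'i set \<Rightarrow> 'a set \<Rightarrow> bool" where
  "delta_family h r C \<longleftrightarrow> finite r \<and>
     (\<forall>\<alpha>\<in>C. \<forall>\<beta>\<in>C. \<alpha> \<noteq> \<beta> \<longrightarrow> dom (h \<alpha>) \<inter> dom (h \<beta>) \<subseteq> r \<and> (\<forall>i\<in>r. h \<alpha> i = h \<beta> i))"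

text \<open>The \<open>\<Delta>\<close>-system lemma for more than \<open>|'u|\<close> finite functions with values in \<open>'u\<close>. Since the
  domains are finite, it only takes that a union of at most \<open>|'u|\<close> sets of size at most \<open>|'u|\<close> has
  size at most \<open>|'u|\<close>, and induction on the size of the domains: a point that lies in too many
  domains is put into the root after fixing its value. If there is no such point then a maximal
  subfamily with disjoint domains is large, because otherwise only few domains could meet those
  of its members.\<close>

lemma delta_system_bounded:
  fixes h :: "'a \<Rightarrow> 'i \<rightharpoonup> 'u"
  assumes inf: "infinite (UNIV :: 'u set)"
    and "\<not> |A| \<le>o |UNIV :: 'u set|"
    and "\<And>\<alpha>. \<alpha> \<in> A \<Longrightarrow> finite (dom (h \<alpha>)) \<and> card (dom (h \<alpha>)) \<le> d"
  shows "\<exists>C\<subseteq>A. \<exists>r. \<not> |C| \<le>o |UNIV :: 'u set| \<and> delta_family h r C"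
  using assms(2,3)
proof (induction d arbitrary: A h)
  case 0
  then have "\<forall>\<alpha>\<in>A. dom (h \<alpha>) = {}" by (meson card_0_eq le_zero_eq)
  then have "delta_family h {} A" by (simp add: delta_family_def)
  with 0(1) show ?case by blast
next
  case (Suc d)
  show ?case
  proof (cases "\<exists>i. \<not> |{\<alpha> \<in> A. i \<in> dom (h \<alpha>)}| \<le>o |UNIV :: 'u set|")
    case True
    then obtain i where i: "\<not> |{\<alpha> \<in> A. i \<in> dom (h \<alpha>)}| \<le>o |UNIV :: 'u set|" by blast
    let ?Ai = "{\<alpha> \<in> A. i \<in> dom (h \<alpha>)}"
    have "|(\<lambda>\<alpha>. the (h \<alpha> i)) ` ?Ai| \<le>o |UNIV :: 'u set|" by (rule card_of_mono1) simp
    from large_fibre[OF inf i this] obtain c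
      where c: "\<not> |{\<alpha> \<in> ?Ai. the (h \<alpha> i) = c}| \<le>o |UNIV :: 'u set|" by blast
    let ?A = "{\<alpha> \<in> ?Ai. the (h \<alpha> i) = c}"
    have val: "h \<alpha> i = Some c" if "\<alpha> \<in> ?A" for \<alpha> using that by auto
    have "finite (dom ((h \<alpha>)(i := None))) \<and> card (dom ((h \<alpha>)(i := None))) \<le> d" if "\<alpha> \<in> ?A" for \<alpha>
      using Suc.prems(2)[of \<alpha>] that by (auto simp: card_Diff_singleton)
    with Suc.IH[OF c, of "\<lambda>\<alpha>. (h \<alpha>)(i := None)"] obtain C r
      where C: "C \<subseteq> ?A" "\<not> |C| \<le>o |UNIV :: 'u set|"
        and r: "delta_family (\<lambda>\<alpha>. (h \<alpha>)(i := None)) r C"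
      by blast
    have "dom (h \<alpha>) \<inter> dom (h \<beta>) \<subseteq> insert i r \<and> (\<forall>i'\<in>insert i r. h \<alpha> i' = h \<beta> i')"
      if "\<alpha> \<in> C" "\<beta> \<in> C" "\<alpha> \<noteq> \<beta>" for \<alpha> \<beta>
    proof -
      have eq: "h \<alpha> i = h \<beta> i" using val C(1) that by (metis subsetD)
      have "dom (h \<alpha>) \<inter> dom (h \<beta>) - {i} \<subseteq> r"
        and same: "\<forall>i'\<in>r. ((h \<alpha>)(i := None)) i' = ((h \<beta>)(i := None)) i'"
        using r that unfolding delta_family_def by fastforce+
      moreover have "h \<alpha> i' = h \<beta> i'" if "i' \<in> r" for i'
        using bspec[OF same that] eq by (simp split: if_splits)
      ultimately show ?thesis using eq by blast
    qed
    then have "delta_family h (insert i r) C" using r unfolding delta_family_def by blast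
    with C show ?thesis by blast
  next
    case False
    define F where "F = {C. C \<subseteq> A \<and> (\<forall>\<alpha>\<in>C. \<forall>\<beta>\<in>C. \<alpha> \<noteq> \<beta> \<longrightarrow> dom (h \<alpha>) \<inter> dom (h \<beta>) = {})}"
    have "\<exists>C\<in>F. \<forall>C'\<in>F. C \<subseteq> C' \<longrightarrow> C' = C"
    proof (rule subset_Zorn_nonempty)
      have "{} \<in> F" by (simp add: F_def)
      then show "F \<noteq> {}" by blast
      fix \<C> assume ch: "subset.chain F \<C>"
      have sub: "\<C> \<subseteq> F" using ch unfolding subset_chain_def by (rule conjunct1)
      have lin: "\<forall>C\<in>\<C>. \<forall>C'\<in>\<C>. C \<subseteq> C' \<or> C' \<subseteq> C"
        using ch unfolding subset_chain_def by (rule conjunct2)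
      have "dom (h \<alpha>) \<inter> dom (h \<beta>) = {}" if mem: "\<alpha> \<in> \<Union>\<C>" "\<beta> \<in> \<Union>\<C>" and "\<alpha> \<noteq> \<beta>"
        for \<alpha> \<beta>
      proof -
        obtain C C' where "C \<in> \<C>" "C' \<in> \<C>" "\<alpha> \<in> C" "\<beta> \<in> C'" using mem by blast
        moreover have "C \<subseteq> C' \<or> C' \<subseteq> C"
          using bspec[OF bspec[OF lin calculation(1)] calculation(2)] .
        ultimately obtain E where E: "E \<in> \<C>" "\<alpha> \<in> E" "\<beta> \<in> E" by blast
        from subsetD[OF sub E(1)] have "E \<in> F" .
        with E(2,3) \<open>\<alpha> \<noteq> \<beta>\<close> show ?thesis by (simp add: F_def)
      qed
      moreover have "\<Union>\<C> \<subseteq> A" using sub by (auto simp: F_def)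
      ultimately show "\<Union>\<C> \<in> F" by (simp add: F_def)
    qed
    then obtain C where C: "C \<in> F" and max: "\<And>C'. C' \<in> F \<Longrightarrow> C \<subseteq> C' \<Longrightarrow> C' = C" by blast
    have CA: "C \<subseteq> A" and disj: "\<forall>\<alpha>\<in>C. \<forall>\<beta>\<in>C. \<alpha> \<noteq> \<beta> \<longrightarrow> dom (h \<alpha>) \<inter> dom (h \<beta>) = {}"
      using C by (simp_all add: F_def)
    have "\<not> |C| \<le>o |UNIV :: 'u set|"
    proof
      assume small: "|C| \<le>o |UNIV :: 'u set|"
      have "|\<Union>\<beta>\<in>C. dom (h \<beta>)| \<le>o |UNIV :: 'u set|"
      proof (rule card_of_UNION_ordLeq_infinite[OF inf small], rule ballI)
        fix \<beta> assume "\<beta> \<in> C"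
        then have "finite (dom (h \<beta>))" using CA Suc.prems(2) by blast
        then show "|dom (h \<beta>)| \<le>o |UNIV :: 'u set|" using inf by (rule finite_imp_small)
      qed
      then have "|\<Union>i\<in>(\<Union>\<beta>\<in>C. dom (h \<beta>)). {\<alpha> \<in> A. i \<in> dom (h \<alpha>)}| \<le>o |UNIV :: 'u set|"
        by (rule card_of_UNION_ordLeq_infinite[OF inf]) (use False in blast)
      then have "|C \<union> (\<Union>i\<in>(\<Union>\<beta>\<in>C. dom (h \<beta>)). {\<alpha> \<in> A. i \<in> dom (h \<alpha>)})| \<le>o |UNIV :: 'u set|"
        by (rule small_Un[OF inf small])
      moreover have "A \<subseteq> C \<union> (\<Union>i\<in>(\<Union>\<beta>\<in>C. dom (h \<beta>)). {\<alpha> \<in> A. i \<in> dom (h \<alpha>)})"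
      proof
        fix \<alpha> assume \<alpha>: "\<alpha> \<in> A"
        show "\<alpha> \<in> C \<union> (\<Union>i\<in>(\<Union>\<beta>\<in>C. dom (h \<beta>)). {\<alpha> \<in> A. i \<in> dom (h \<alpha>)})"
        proof (rule ccontr)
          assume not: "\<not> ?thesis"
          then have "dom (h \<alpha>) \<inter> dom (h \<beta>) = {}" if "\<beta> \<in> C" for \<beta> using that \<alpha> by blast
          then have "insert \<alpha> C \<in> F" using CA disj \<alpha> unfolding F_def by blast
          with max[of "insert \<alpha> C"] not show False by blast
        qed
      qed
      ultimately have "|A| \<le>o |UNIV :: 'u set|"
        using card_of_mono1 ordLeq_transitive by blast
      with Suc.prems(1) show False ..
    qed
    moreover have "delta_family h {} C" using disj by (simp add: delta_family_def)
    ultimately show ?thesis using CA by blast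
  qed
qed

lemma delta_system:
  fixes h :: "'a \<Rightarrow> 'i \<rightharpoonup> 'u"
  assumes inf: "infinite (UNIV :: 'u set)"
    and large: "\<not> |A| \<le>o |UNIV :: 'u set|"
    and fin: "\<And>\<alpha>. \<alpha> \<in> A \<Longrightarrow> finite (dom (h \<alpha>))"
  shows "\<exists>C\<subseteq>A. \<exists>r. \<not> |C| \<le>o |UNIV :: 'u set| \<and> delta_family h r C"
proof -
  have "|UNIV :: nat set| \<le>o |UNIV :: 'u set|" using inf infinite_iff_card_of_nat by blast
  then have "|(\<lambda>\<alpha>. card (dom (h \<alpha>))) ` A| \<le>o |UNIV :: 'u set|"
    by (rule ordLeq_transitive[OF card_of_mono1[OF subset_UNIV]])
  from large_fibre[OF inf large this] obtain d
    where d: "\<not> |{\<alpha> \<in> A. card (dom (h \<alpha>)) = d}| \<le>o |UNIV :: 'u set|" by blast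
  have "\<exists>C\<subseteq>{\<alpha> \<in> A. card (dom (h \<alpha>)) = d}. \<exists>r.
      \<not> |C| \<le>o |UNIV :: 'u set| \<and> delta_family h r C"
    by (rule delta_system_bounded[OF inf d, where d = d]) (use fin in auto)
  then show ?thesis by blast
qed


section \<open>The pattern of thin families of generic branches\<close>

text \<open>Since \<open>f\<close> is strictly increasing, only the first \<open>card u\<close> levels can matter for the thinness of
  \<open>u\<close>: a node of level \<open>n\<close> has \<open>f n + 1 > n\<close> successors, and each of them needs a branch of its
  own.\<close>

lemma covered_node_length:
  fixes f :: "nat \<Rightarrow> nat"
  assumes f: "strict_mono f" and u: "finite u"
    and cov: "\<And>l. l \<le> f (length \<rho>) \<Longrightarrow> \<exists>\<alpha>\<in>u. map (B \<alpha>) [0..<Suc (length \<rho>)] = \<rho> @ [l]"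
  shows "length \<rho> < card u"
proof -
  obtain \<gamma> where \<gamma>: "\<And>l. l \<le> f (length \<rho>) \<Longrightarrow>
      \<gamma> l \<in> u \<and> map (B (\<gamma> l)) [0..<Suc (length \<rho>)] = \<rho> @ [l]"
    using cov by metis
  have "inj_on \<gamma> {..f (length \<rho>)}"
    by (rule inj_onI) (metis \<gamma> atMost_iff append1_eq_conv)
  then have "card {..f (length \<rho>)} \<le> card u"
    using \<gamma> u by (intro card_inj_on_le) auto
  moreover have "length \<rho> \<le> f (length \<rho>)" using f by (rule strict_mono_imp_increasing)
  ultimately show ?thesis by simp
qed

lemma thin_branches_transfer:
  assumes f: "strict_mono f" and u: "finite u"
    and eq: "\<And>\<alpha> k. \<alpha> \<in> u \<Longrightarrow> k < card u \<Longrightarrow> B \<alpha> k = B' \<alpha> k"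
    and thin: "thin_branches f B u"
  shows "thin_branches f B' u"
proof (rule ccontr)
  assume "\<not> ?thesis"
  then obtain \<rho> where cov:
      "\<And>l. l \<le> f (length \<rho>) \<Longrightarrow> \<exists>\<alpha>\<in>u. map (B' \<alpha>) [0..<Suc (length \<rho>)] = \<rho> @ [l]"
    unfolding thin_branches_def by blast
  have "length \<rho> < card u" by (rule covered_node_length[OF f u cov])
  then have "map (B \<alpha>) [0..<Suc (length \<rho>)] = map (B' \<alpha>) [0..<Suc (length \<rho>)]" if "\<alpha> \<in> u" for \<alpha>
    using eq[OF that] by simp
  then have "\<exists>\<alpha>\<in>u. map (B \<alpha>) [0..<Suc (length \<rho>)] = \<rho> @ [l]" if "l \<le> f (length \<rho>)" for l
    using cov[OF that] by metis
  with thin show False unfolding thin_branches_def by blast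
qed

lemma depends_on_thin_branches:
  fixes B :: "('i \<Rightarrow> 'u) \<Rightarrow> 'k \<Rightarrow> nat \<Rightarrow> nat"
  assumes f: "strict_mono f" and u: "finite u"
    and B: "\<And>g g' \<alpha> k. g (e \<alpha> k) = g' (e \<alpha> k) \<Longrightarrow> B g \<alpha> k = B g' \<alpha> k"
    and J: "\<And>\<alpha> k. \<alpha> \<in> u \<Longrightarrow> k < card u \<Longrightarrow> e \<alpha> k \<in> J"
  shows "depends_on (\<lambda>g. thin_branches f (B g) u) J"
  unfolding depends_on_def
proof (intro allI impI iffI)
  fix g g' :: "'i \<Rightarrow> 'u" assume "\<forall>i\<in>J. g i = g' i"
  then have eq: "B g \<alpha> k = B g' \<alpha> k" if "\<alpha> \<in> u" "k < card u" for \<alpha> k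
    using B J[OF that] by blast
  show "thin_branches f (B g') u" if "thin_branches f (B g) u"
    using that thin_branches_transfer[OF f u, of "B g" "B g'"] eq by metis
  show "thin_branches f (B g) u" if "thin_branches f (B g') u"
    using that thin_branches_transfer[OF f u, of "B g'" "B g"] eq by metis
qed

text \<open>A condition that decides the relevant part of all branches indexed by \<open>w\<close> determines for
  each \<open>u \<subseteq> w\<close> whether \<open>u\<close> is thin, and by model completion this is the same as the
  consistency of the corresponding instances of \<open>R\<close>.\<close>

lemma thin_branches_possibility_pattern:
  fixes X :: "('i \<rightharpoonup> 'u) \<Rightarrow> 'b::{boolean_algebra, complete_lattice}"
    and B :: "('i \<Rightarrow> 'u) \<Rightarrow> 'k \<Rightarrow> nat \<Rightarrow> nat"
  assumes f: "strict_mono f" and pos: "\<And>n. f n \<noteq> 0" and inf: "infinite (UNIV :: 'm set)"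
    and mc: "model_completion TYPE('m) (vocab f) (T0 f) T"
    and X: "free_completion X"
    and le: "\<And>g \<alpha> k. B g \<alpha> k \<le> f k"
    and B: "\<And>g g' \<alpha> k. g (e \<alpha> k) = g' (e \<alpha> k) \<Longrightarrow> B g \<alpha> k = B g' \<alpha> k"
    and nonzero: "\<And>u. finite u \<Longrightarrow> bool_value X (\<lambda>g. thin_branches f (B g) u) \<noteq> bot"
  shows "possibility_pattern TYPE('m) T (\<lambda>\<alpha>. Rel R [0, 1])
    (\<lambda>u :: 'k set. bool_value X (\<lambda>g. thin_branches f (B g) u))"
  unfolding possibility_pattern_def
proof (intro conjI allI impI; (elim conjE)?)
  show "bool_value X (\<lambda>g. thin_branches f (B g) u) \<noteq> bot" if "finite u" for u
    using nonzero that .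
  show "bool_value X (\<lambda>g. thin_branches f (B g) u) \<le> bool_value X (\<lambda>g. thin_branches f (B g) v)"
    if "v \<subseteq> u" for u v
    using thin_branches_mono that by (intro bool_value_mono) blast
next
  fix w :: "'k set" and c
  assume w: "finite w" and c: "c \<noteq> bot"
    and dec: "\<forall>u\<subseteq>w. c \<le> bool_value X (\<lambda>g. thin_branches f (B g) u) \<or>
      inf c (bool_value X (\<lambda>g. thin_branches f (B g) u)) = bot"
  let ?J = "(\<lambda>(\<alpha>, k). e \<alpha> k) ` (w \<times> {..<card w})"
  have "finite ?J" using w by simp
  from exists_condition_below[OF X c this]
  obtain g I where I: "finite I" "?J \<subseteq> I" and below: "X ((Some \<circ> g) |` I) \<le> c" by blast
  let ?h = "(Some \<circ> g) |` I"
  have fin: "finite (dom ?h)" using I(1) by (simp only: dom_restrict_total)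
  have c_iff: "c \<le> bool_value X (\<lambda>g. thin_branches f (B g) u) \<longleftrightarrow> thin_branches f (B g) u"
    if u: "u \<subseteq> w" for u
  proof -
    have "card u \<le> card w" "finite u" using u w card_mono finite_subset by auto
    then have dep: "depends_on (\<lambda>g. thin_branches f (B g) u) ?J"
      using u by (intro depends_on_thin_branches[OF f _ B]) auto
    have "thin_branches f (B g) u" if "c \<le> bool_value X (\<lambda>g. thin_branches f (B g) u)"
    proof (rule ccontr)
      assume "\<not> ?thesis"
      moreover have "depends_on (\<lambda>g. \<not> thin_branches f (B g) u) ?J"
        using dep unfolding depends_on_def by metis
      ultimately have "forces ?h (\<lambda>g. \<not> thin_branches f (B g) u)"
        using forces_restrict[OF _ I(2)] by blast
      from bool_value_eq_bot_below[OF X fin this] have "X ?h = bot"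
        using order_trans[OF below that] by (simp add: inf.absorb1)
      with condition_nonzero[OF X fin] show False ..
    qed
    moreover have "c \<le> bool_value X (\<lambda>g. thin_branches f (B g) u)" if "thin_branches f (B g) u"
    proof -
      have "forces ?h (\<lambda>g. thin_branches f (B g) u)" using forces_restrict[OF dep I(2)] that by blast
      from le_bool_value[OF fin this, of X] below
      have "X ?h \<le> inf c (bool_value X (\<lambda>g. thin_branches f (B g) u))" by simp
      then have "inf c (bool_value X (\<lambda>g. thin_branches f (B g) u)) \<noteq> bot"
        using condition_nonzero[OF X fin] by (metis bot_unique)
      with dec u show ?thesis by blast
    qed
    ultimately show ?thesis by blast
  qed
  have "\<exists>(N :: (sym, 'm) struct) a. models N T \<and> (\<forall>\<alpha>\<in>w. a \<alpha> \<in> univ N) \<and>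
    (\<forall>u\<subseteq>w. (\<exists>x\<in>univ N. \<forall>\<alpha>\<in>u. interp N R [x, a \<alpha>]) \<longleftrightarrow> thin_branches f (B g) u)"
    by (rule model_completion_thin[OF mc inf pos w le])
  then obtain N :: "(sym, 'm) struct" and a where N: "models N T" "\<forall>\<alpha>\<in>w. a \<alpha> \<in> univ N"
    and iff: "\<And>u. u \<subseteq> w \<Longrightarrow>
      (\<exists>x\<in>univ N. \<forall>\<alpha>\<in>u. interp N R [x, a \<alpha>]) \<longleftrightarrow> thin_branches f (B g) u"
    by blast
  have "(\<exists>x\<in>univ N. \<forall>\<alpha>\<in>u. sat N ((\<lambda>_. a \<alpha>)(0 := x)) (Rel R [0, 1])) \<longleftrightarrow>
      c \<le> bool_value X (\<lambda>g. thin_branches f (B g) u)" if "u \<subseteq> w" for u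
    using iff[OF that] c_iff[OF that] by simp
  with N show "\<exists>(M :: (sym, 'm) struct) a. models M T \<and> (\<forall>\<alpha>\<in>w. \<forall>i. a \<alpha> i \<in> univ M) \<and>
      (\<forall>u\<subseteq>w. (\<exists>x\<in>univ M. \<forall>\<alpha>\<in>u. sat M ((a \<alpha>)(0 := x)) (Rel R [0, 1])) \<longleftrightarrow>
        c \<le> bool_value X (\<lambda>g. thin_branches f (B g) u))"
    by (intro exI[of _ N] exI[of _ "\<lambda>\<alpha> _. a \<alpha>"]) blast
qed

text \<open>If the ultrafilter sends every branch to \<open>0\<close> at every level then it believes each finite
  family to be thin: by strict growth of \<open>f\<close> this belief involves finitely many levels only, and on
  these the branches are constantly \<open>0\<close> and never use the successor \<open>1\<close> of a node.\<close>

lemma thin_branches_in_ultrafilter: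
  fixes X :: "('i \<rightharpoonup> 'u) \<Rightarrow> 'b::{boolean_algebra, complete_lattice}"
    and B :: "('i \<Rightarrow> 'u) \<Rightarrow> 'k \<Rightarrow> nat \<Rightarrow> nat"
  assumes f: "strict_mono f" and pos: "\<And>n. f n \<noteq> 0"
    and X: "free_completion X" and D: "ultrafilter D"
    and zero: "\<And>\<alpha> k. bool_value X (\<lambda>g. B g \<alpha> k = 0) \<in> D"
    and u: "finite u"
  shows "bool_value X (\<lambda>g. thin_branches f (B g) u) \<in> D"
proof -
  have zeros: "bool_value X (\<lambda>g. \<forall>p\<in>u \<times> {..<card u}. B g (fst p) (snd p) = 0) \<in> D"
    by (rule bool_value_ball[OF X D]) (use u zero in auto)
  have "thin_branches f (\<lambda>_ _. 0) u"
    unfolding thin_branches_def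
  proof
    fix \<rho> :: "nat list"
    have "1 \<le> f (length \<rho>)" using pos[of "length \<rho>"] by simp
    then show "\<exists>l\<le>f (length \<rho>). \<forall>\<alpha>\<in>u. map (\<lambda>_. 0) [0..<Suc (length \<rho>)] \<noteq> \<rho> @ [l]"
      by (intro exI[of _ 1]) simp
  qed
  then have thin: "thin_branches f (B g) u"
    if "\<forall>p\<in>u \<times> {..<card u}. B g (fst p) (snd p) = 0" for g
    using thin_branches_transfer[OF f u, of "\<lambda>_ _. 0" "B g"] that by auto
  show ?thesis by (intro ultrafilter_upward[OF D zeros] bool_value_mono thin)
qed


section \<open>The pattern has no multiplicative refinement\<close>

lemma multiplicative_refinement_lower_bound:
  assumes mult: "multiplicative_refinement b b'"
    and u: "finite u" "u \<noteq> {}" and z: "\<And>\<alpha>. \<alpha> \<in> u \<Longrightarrow> z \<le> b' {\<alpha>}"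
  shows "z \<le> b u"
proof -
  have "z \<le> b' u"
    using u z
  proof (induction u rule: finite_ne_induct)
    case (insert \<alpha> u)
    then have "z \<le> inf (b' {\<alpha>}) (b' u)" by auto
    also have "\<dots> = b' (insert \<alpha> u)"
      using mult insert.hyps unfolding multiplicative_refinement_def by simp
    finally show ?case .
  qed simp
  also have "b' u \<le> b u" using mult u unfolding multiplicative_refinement_def by blast
  finally show ?thesis .
qed

text \<open>Each \<open>b' {\<alpha>}\<close> lies above a condition, which fixes the branch of \<open>\<alpha>\<close> up to some node and
  says nothing about the next coordinate of that branch. By the \<open>\<Delta>\<close>-system lemma there is a
  large family of indices for which the node is the same, the conditions are compatible, and no
  condition mentions the next coordinate of a branch of the family. Finitely many of
  these branches can then be sent to all successors of the node, against the thinness of their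
  family.\<close>

lemma no_multiplicative_refinement:
  fixes X :: "('i \<rightharpoonup> 'u) \<Rightarrow> 'b::{boolean_algebra, complete_lattice}"
    and e :: "'k \<Rightarrow> nat \<Rightarrow> 'i"
  assumes X: "free_completion X" and inf: "infinite (UNIV :: 'u set)"
    and large: "\<not> |K| \<le>o |UNIV :: 'u set|" and e: "inj_on (\<lambda>(\<alpha>, k). e \<alpha> k) (K \<times> UNIV)"
    and label: "\<And>k i l. l \<le> f k \<Longrightarrow> \<exists>v. label i k v = l"
    and nonzero: "\<And>\<alpha>. b' {\<alpha>} \<noteq> bot"
    and mult: "multiplicative_refinement
      (\<lambda>u. bool_value X (\<lambda>g. thin_branches f (\<lambda>\<alpha> k. label (e \<alpha> k) k (g (e \<alpha> k))) u)) b'"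
  shows False
proof -
  define B where "B = (\<lambda>g \<alpha> k. label (e \<alpha> k) k (g (e \<alpha> k)))"
  have e_eq: "e \<alpha> k = e \<beta> m \<longleftrightarrow> \<alpha> = \<beta> \<and> k = m" if "\<alpha> \<in> K" "\<beta> \<in> K" for \<alpha> \<beta> k m
    using inj_onD[OF e, of "(\<alpha>, k)" "(\<beta>, m)"] that by auto
  have "\<exists>g I. finite I \<and> X ((Some \<circ> g) |` I) \<le> b' {\<alpha>}" for \<alpha>
    using exists_condition_below[OF X nonzero finite.emptyI] by blast
  then obtain g I where I: "\<And>\<alpha>. finite (I \<alpha>)"
    and below: "\<And>\<alpha>. X ((Some \<circ> g \<alpha>) |` I \<alpha>) \<le> b' {\<alpha>}"
    by metis
  \<comment> \<open>The branch of \<open>\<alpha>\<close> is decided below level \<open>n \<alpha>\<close> and still free at this level.\<close>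
  define n where "n = (\<lambda>\<alpha>. LEAST k. e \<alpha> k \<notin> I \<alpha>)"
  have n: "e \<alpha> (n \<alpha>) \<notin> I \<alpha>" if "\<alpha> \<in> K" for \<alpha>
  proof -
    have "inj (e \<alpha>)" using e_eq that by (auto intro: injI)
    then have "infinite (range (e \<alpha>))" using finite_imageD infinite_UNIV_nat by metis
    then have "\<not> range (e \<alpha>) \<subseteq> I \<alpha>" using finite_subset[OF _ I[of \<alpha>]] by blast
    then have "\<exists>k. e \<alpha> k \<notin> I \<alpha>" by blast
    then show ?thesis unfolding n_def by (rule LeastI_ex)
  qed
  have less_n: "e \<alpha> k \<in> I \<alpha>" if "k < n \<alpha>" for \<alpha> k
    using not_less_Least[of k "\<lambda>k. e \<alpha> k \<notin> I \<alpha>"] that by (auto simp: n_def)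
  define node where "node = (\<lambda>\<alpha>. map (B (g \<alpha>) \<alpha>) [0..<n \<alpha>])"
  have "|UNIV :: nat list set| \<le>o |UNIV :: nat set|"
    by (rule card_of_ordLeqI[OF inj_to_nat]) simp
  also have nat_le: "|UNIV :: nat set| \<le>o |UNIV :: 'u set|"
    using inf infinite_iff_card_of_nat by blast
  finally have "|node ` K| \<le>o |UNIV :: 'u set|"
    by (rule ordLeq_transitive[OF card_of_mono1[OF subset_UNIV]])
  from large_fibre[OF inf large this] obtain \<rho>
    where K': "\<not> |{\<alpha> \<in> K. node \<alpha> = \<rho>}| \<le>o |UNIV :: 'u set|" by blast
  let ?K' = "{\<alpha> \<in> K. node \<alpha> = \<rho>}"
  let ?n = "length \<rho>"
  have n_eq: "n \<alpha> = ?n" if "\<alpha> \<in> ?K'" for \<alpha>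
    using that by (auto simp: node_def)
  \<comment> \<open>Putting the next coordinate of each branch into the domains makes the \<open>\<Delta>\<close>-system lemma
    separate it from the other conditions.\<close>
  define h where "h = (\<lambda>\<alpha>. (Some \<circ> g \<alpha>) |` insert (e \<alpha> ?n) (I \<alpha>))"
  have dom_h: "dom (h \<alpha>) = insert (e \<alpha> ?n) (I \<alpha>)" for \<alpha>
    unfolding h_def by (rule dom_restrict_total)
  have "finite (dom (h \<alpha>))" for \<alpha> using I by (simp add: dom_h)
  then obtain C r where C: "C \<subseteq> ?K'" "\<not> |C| \<le>o |UNIV :: 'u set|" and delta: "delta_family h r C"
    using delta_system[OF inf K', of h] by metis
  have r: "finite r"
    and dom_r: "\<And>\<alpha> \<beta>. \<alpha> \<in> C \<Longrightarrow> \<beta> \<in> C \<Longrightarrow> \<alpha> \<noteq> \<beta> \<Longrightarrow> dom (h \<alpha>) \<inter> dom (h \<beta>) \<subseteq> r"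
    and eq_r: "\<And>\<alpha> \<beta> i. \<alpha> \<in> C \<Longrightarrow> \<beta> \<in> C \<Longrightarrow> \<alpha> \<noteq> \<beta> \<Longrightarrow> i \<in> r \<Longrightarrow> h \<alpha> i = h \<beta> i"
    using delta unfolding delta_family_def by blast+
  let ?bad = "{\<alpha> \<in> C. e \<alpha> ?n \<in> r}"
  have "finite ((\<lambda>\<alpha>. e \<alpha> ?n) ` ?bad)" by (rule finite_subset[OF _ r]) blast
  moreover have "inj_on (\<lambda>\<alpha>. e \<alpha> ?n) ?bad"
    using e_eq subsetD[OF C(1)] by (auto intro!: inj_onI)
  ultimately have "finite ?bad" by (rule finite_imageD)
  moreover have "infinite C" using C(2) finite_imp_small[OF _ inf, of C] by metis
  ultimately have "infinite (C - ?bad)" by simp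
  moreover have "C - ?bad = {\<alpha> \<in> C. e \<alpha> ?n \<notin> r}" by blast
  ultimately have "infinite {\<alpha> \<in> C. e \<alpha> ?n \<notin> r}" by simp
  from infinite_arbitrarily_large[OF this, of "card {..f ?n}"]
  obtain u where u: "finite u" "card u = card {..f ?n}" "u \<subseteq> {\<alpha> \<in> C. e \<alpha> ?n \<notin> r}" by blast
  obtain succ where succ: "bij_betw succ u {..f ?n}"
    using finite_same_card_bij[OF u(1) _ u(2)] by blast
  have uK: "\<alpha> \<in> K" "node \<alpha> = \<rho>" "n \<alpha> = ?n" "\<alpha> \<in> C" if "\<alpha> \<in> u" for \<alpha>
    using subsetD[OF u(3) that] subsetD[OF C(1)] n_eq by auto
  have fresh: "e \<beta> ?n \<notin> I \<alpha>" if "\<alpha> \<in> u" "\<beta> \<in> u" for \<alpha> \<beta>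
  proof (cases "\<alpha> = \<beta>")
    case True
    then show ?thesis using n[OF uK(1)] uK(3) that by metis
  next
    case False
    then have "dom (h \<alpha>) \<inter> dom (h \<beta>) \<subseteq> r" using dom_r uK(4) that by blast
    moreover have "e \<beta> ?n \<notin> r" using u(3) that by blast
    ultimately show ?thesis by (auto simp: dom_h)
  qed
  have agree: "g \<alpha> i = g \<beta> i" if "\<alpha> \<in> u" "\<beta> \<in> u" "i \<in> I \<alpha>" "i \<in> I \<beta>" for \<alpha> \<beta> i
  proof (cases "\<alpha> = \<beta>")
    case False
    then have "i \<in> r" using dom_r[OF uK(4) uK(4)] that by (auto simp: dom_h)
    then have "h \<alpha> i = h \<beta> i" using eq_r uK(4) that False by blast
    with that show ?thesis by (simp add: h_def)
  qed simp
  have "\<exists>v. label (e \<alpha> ?n) ?n v = succ \<alpha>" if "\<alpha> \<in> u" for \<alpha>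
    using label[of "succ \<alpha>" ?n] bij_betwE[OF succ] that by auto
  then obtain v where v: "\<And>\<alpha>. \<alpha> \<in> u \<Longrightarrow> label (e \<alpha> ?n) ?n (v \<alpha>) = succ \<alpha>" by metis
  \<comment> \<open>The union of the conditions, extended so that \<open>\<alpha>\<close> moves from \<open>\<rho>\<close> to its successor \<open>succ \<alpha>\<close>.\<close>
  define g' where "g' = (\<lambda>i. if \<exists>\<alpha>\<in>u. i = e \<alpha> ?n then v (SOME \<alpha>. \<alpha> \<in> u \<and> i = e \<alpha> ?n)
    else g (SOME \<alpha>. \<alpha> \<in> u \<and> i \<in> I \<alpha>) i)"
  have g'_v: "g' (e \<alpha> ?n) = v \<alpha>" if "\<alpha> \<in> u" for \<alpha>
  proof -
    have "(SOME \<beta>. \<beta> \<in> u \<and> e \<alpha> ?n = e \<beta> ?n) = \<alpha>"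
      using e_eq uK(1) that by (intro some_equality) auto
    with that show ?thesis by (auto simp: g'_def)
  qed
  have g'_g: "g' i = g \<alpha> i" if "\<alpha> \<in> u" "i \<in> I \<alpha>" for \<alpha> i
  proof -
    define \<beta> where "\<beta> = (SOME \<beta>. \<beta> \<in> u \<and> i \<in> I \<beta>)"
    have \<beta>: "\<beta> \<in> u \<and> i \<in> I \<beta>"
      unfolding \<beta>_def by (rule someI) (use that in blast)
    have "\<not> (\<exists>\<beta>\<in>u. i = e \<beta> ?n)" using fresh[OF that(1)] that(2) by blast
    then have "g' i = g \<beta> i" by (simp add: g'_def \<beta>_def)
    also have "\<dots> = g \<alpha> i" using \<beta> that by (intro agree) auto
    finally show ?thesis .
  qed
  let ?I = "\<Union>\<alpha>\<in>u. insert (e \<alpha> ?n) (I \<alpha>)"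
  let ?h = "(Some \<circ> g') |` ?I"
  have fin: "finite (dom ?h)" unfolding dom_restrict_total using u(1) I by simp
  have "X ?h \<le> b' {\<alpha>}" if "\<alpha> \<in> u" for \<alpha>
  proof -
    have "(Some \<circ> g \<alpha>) |` I \<alpha> \<subseteq>\<^sub>m ?h"
      unfolding map_le_def dom_restrict_total
    proof
      fix i assume i: "i \<in> I \<alpha>"
      then have "i \<in> ?I" using that by blast
      with i show "((Some \<circ> g \<alpha>) |` I \<alpha>) i = ?h i" using g'_g[OF that i] by simp
    qed
    from condition_antimono[OF X fin this] below show ?thesis by (rule order_trans)
  qed
  moreover have "u \<noteq> {}" using u(1,2) by auto
  ultimately have le: "X ?h \<le> bool_value X (\<lambda>g. thin_branches f (B g) u)"
    unfolding B_def by (intro multiplicative_refinement_lower_bound[OF mult u(1)])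
  have "\<not> thin_branches f (B g'') u" if ext: "?h \<subseteq>\<^sub>m Some \<circ> g''" for g''
  proof -
    have g'': "g'' i = g' i" if "i \<in> ?I" for i
      using ext that unfolding restrict_total_le_iff by blast
    have "\<exists>\<alpha>\<in>u. map (B g'' \<alpha>) [0..<Suc ?n] = \<rho> @ [l]" if l: "l \<le> f ?n" for l
    proof -
      obtain \<alpha> where \<alpha>: "\<alpha> \<in> u" "succ \<alpha> = l" 
        using bij_betw_imp_surj_on[OF succ] l by (metis atMost_iff imageE)
      have "g'' (e \<alpha> ?n) = v \<alpha>" using g''[of "e \<alpha> ?n"] g'_v \<alpha>(1) by auto
      then have top: "B g'' \<alpha> ?n = l" using v \<alpha> by (simp add: B_def)
      have "B g'' \<alpha> k = B (g \<alpha>) \<alpha> k" if "k < ?n" for k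
      proof -
        have mem: "e \<alpha> k \<in> I \<alpha>" using less_n uK(3)[OF \<alpha>(1)] that by simp
        then have "e \<alpha> k \<in> ?I" using \<alpha>(1) by blast
        from g''[OF this] have "g'' (e \<alpha> k) = g \<alpha> (e \<alpha> k)" using g'_g[OF \<alpha>(1) mem] by simp
        then show ?thesis by (simp add: B_def)
      qed
      then have "map (B g'' \<alpha>) [0..<?n] = map (B (g \<alpha>) \<alpha>) [0..<?n]" by simp
      also have "\<dots> = \<rho>" using uK(2,3)[OF \<alpha>(1)] by (simp add: node_def)
      finally show ?thesis using top \<alpha>(1) by (intro bexI[of _ \<alpha>]) simp_all
    qed
    then show ?thesis unfolding thin_branches_def by blast
  qed
  then have "forces ?h (\<lambda>g. \<not> thin_branches f (B g) u)" unfolding forces_def by blast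
  from bool_value_eq_bot_below[OF X fin this] le have "X ?h = bot" by (simp add: inf.absorb1)
  with condition_nonzero[OF X fin] show False ..
qed

text \<open>The index type of the partitions has room for countably many partitions for each of more
  than \<open>|'u|\<close> indices, because \<open>|'u| \<le> |'l| < |'l set|\<close>.\<close>

lemma large_set_of_coordinate_sequences:
  assumes inf: "infinite (UNIV :: 'l set)"
    and le: "|UNIV :: 'u set| \<le>o |UNIV :: 'l set|"
    and less: "|UNIV :: 'u set| <o |UNIV :: 'k set|"
  obtains K :: "'k set" and e :: "'k \<Rightarrow> nat \<Rightarrow> 'l set"
  where "\<not> |K| \<le>o |UNIV :: 'u set|" and "inj_on (\<lambda>(\<alpha>, k). e \<alpha> k) (K \<times> UNIV)"
proof -
  have "|UNIV :: 'l set| <o |UNIV :: 'l set set|"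
    using card_of_Pow[of "UNIV :: 'l set"] by simp
  then have less': "|UNIV :: 'u set| <o |UNIV :: 'l set set|" using le ordLeq_ordLess_trans by blast
  have "\<exists>(K :: 'k set) d :: 'k \<Rightarrow> 'l set. inj_on d K \<and> \<not> |K| \<le>o |UNIV :: 'u set|"
  proof (cases "|UNIV :: 'k set| \<le>o |UNIV :: 'l set set|")
    case True
    then obtain d :: "'k \<Rightarrow> 'l set" where "inj d" by (auto simp: card_of_ordLeq[symmetric])
    moreover have "\<not> |UNIV :: 'k set| \<le>o |UNIV :: 'u set|" using less by (rule not_ordLess_ordLeq)
    ultimately show ?thesis by blast
  next
    case False
    then have "|UNIV :: 'l set set| \<le>o |UNIV :: 'k set|"
      using ordLeq_total[OF card_of_Well_order card_of_Well_order] by blast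
    then obtain d :: "'l set \<Rightarrow> 'k" where d: "inj d" by (auto simp: card_of_ordLeq[symmetric])
    have "\<not> |range d| \<le>o |UNIV :: 'u set|"
    proof
      assume small: "|range d| \<le>o |UNIV :: 'u set|"
      have "|UNIV :: 'l set set| \<le>o |range d|" by (rule card_of_ordLeqI[OF d]) simp
      then have "|UNIV :: 'l set set| \<le>o |UNIV :: 'u set|" using small by (rule ordLeq_transitive)
      with not_ordLess_ordLeq[OF less'] show False ..
    qed
    moreover have "inj_on (inv d) (range d)" by (rule inj_on_inv_into) simp
    ultimately show ?thesis by blast
  qed
  then obtain K and d :: "'k \<Rightarrow> 'l set" where K: "inj_on d K" "\<not> |K| \<le>o |UNIV :: 'u set|" by blast
  have infs: "infinite (UNIV :: 'l set set)" using inf by (simp add: Finite_Set.finite_set)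
  then have "|UNIV :: nat set| \<le>o |UNIV :: 'l set set|" using infinite_iff_card_of_nat by blast
  then have "|(UNIV :: 'l set set) \<times> (UNIV :: nat set)| =o |UNIV :: 'l set set|"
    using card_of_Times_infinite[OF infs, of "UNIV :: nat set"] by simp
  then have "|UNIV :: ('l set \<times> nat) set| \<le>o |UNIV :: 'l set set|"
    by (simp add: ordIso_imp_ordLeq)
  then obtain c :: "'l set \<times> nat \<Rightarrow> 'l set" where c: "inj c"
    by (auto simp: card_of_ordLeq[symmetric])
  have "inj_on (\<lambda>(\<alpha>, k). c (d \<alpha>, k)) (K \<times> UNIV)"
  proof (rule inj_onI)
    fix p q assume "p \<in> K \<times> (UNIV :: nat set)" "q \<in> K \<times> (UNIV :: nat set)"
      and "(case p of (\<alpha>, k) \<Rightarrow> c (d \<alpha>, k)) = (case q of (\<alpha>, k) \<Rightarrow> c (d \<alpha>, k))"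
    then show "p = q" using injD[OF c] inj_onD[OF K(1)] by (cases p; cases q) fastforce
  qed
  with K(2) show ?thesis by (rule that)
qed

theorem lemma3p2:
  fixes f :: "nat \<Rightarrow> nat"
    and T_f :: "sym fm set"
    and X :: "('l set \<rightharpoonup> 'u) \<Rightarrow> 'b::{boolean_algebra, complete_lattice}"
    and D :: "'b set"
  assumes "strict_mono f" and "\<And>n. f n \<noteq> 0"
    and "infinite (UNIV :: 'l set)"
    and "infinite (UNIV :: 'u set)"
    and "|UNIV :: 'u set| \<le>o |UNIV :: 'l set|"
    and "|UNIV :: 'u set| <o |UNIV :: 'k set|"
    and "infinite (UNIV :: 'm set)"
    and "model_completion TYPE('m) (vocab f) (T0 f) T_f"
    and "free_completion X"
    and "ultrafilter D"
  shows "\<not> moral TYPE('k) TYPE('m) (vocab f) T_f D"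
proof
  assume moral: "moral TYPE('k) TYPE('m) (vocab f) T_f D"
  obtain K :: "'k set" and e :: "'k \<Rightarrow> nat \<Rightarrow> 'l set"
    where K: "\<not> |K| \<le>o |UNIV :: 'u set|" and e: "inj_on (\<lambda>(\<alpha>, k). e \<alpha> k) (K \<times> UNIV)"
    using large_set_of_coordinate_sequences[OF assms(3,5,6)] by blast
  obtain label :: "'l set \<Rightarrow> nat \<Rightarrow> 'u \<Rightarrow> nat"
    where le: "\<And>i k v. label i k v \<le> f k" and onto: "\<And>i k l. l \<le> f k \<Longrightarrow> \<exists>v. label i k v = l"
      and zero: "\<And>i k. bool_value X (\<lambda>g. label i k (g i) = 0) \<in> D"
    by (rule generic_labels[where f = f, OF assms(9,10,4,2)]) (rule that, assumption+)
  define B where "B = (\<lambda>g \<alpha> k. label (e \<alpha> k) k (g (e \<alpha> k)))"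
  define b where "b = (\<lambda>u :: 'k set. bool_value X (\<lambda>g. thin_branches f (B g) u))"
  have inD: "b u \<in> D" if "finite u" for u
    unfolding b_def
    by (rule thin_branches_in_ultrafilter[OF assms(1,2,9,10) _ that]) (simp add: B_def zero)
  have bot: "bot \<notin> D" using assms(10) unfolding ultrafilter_def by blast
  have "possibility_pattern TYPE('m) T_f (\<lambda>\<alpha>. Rel R [0, 1]) b"
    unfolding b_def
  proof (rule thin_branches_possibility_pattern[OF assms(1,2,7,8,9), where e = e])
    show "B g \<alpha> k \<le> f k" for g \<alpha> k by (simp add: B_def le)
    show "B g \<alpha> k = B g' \<alpha> k" if "g (e \<alpha> k) = g' (e \<alpha> k)" for g g' \<alpha> k
      using that by (simp add: B_def)
    show "bool_value X (\<lambda>g. thin_branches f (B g) u) \<noteq> bot" if "finite u" for u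
      using inD[OF that] bot unfolding b_def by metis
  qed
  moreover have "formula_of (vocab f) (Rel R [0, 1])" by simp
  ultimately have "\<exists>b'. (\<forall>u. finite u \<longrightarrow> b' u \<in> D) \<and> multiplicative_refinement b b'"
    using moral[unfolded moral_def, THEN spec, THEN spec, of "\<lambda>_. Rel R [0, 1]" b] inD by simp
  then obtain b' where b': "\<And>u. finite u \<Longrightarrow> b' u \<in> D" "multiplicative_refinement b b'"
    by auto
  have "b' {\<alpha>} \<noteq> bot" for \<alpha> using b'(1)[of "{\<alpha>}"] bot by auto
  from no_multiplicative_refinement[where f = f and label = label and e = e,
      OF assms(9,4) K e onto this b'(2)[unfolded b_def B_def]]
  show False .
qed

end
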